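(* Let $n\geq1$, let $C_n\subset\hat A^n$ be an arbitrary finite nonempty set, and suppose $D=E_{P_n}[\rho_n(X_1^n,C_n)]$ is finite. Then $$\log M^n(C_n)\geq R_n(D).$$ If $\mathbb P$ is a stationary measure, then for all $n\ge1$, $\log M^n(C_n)\geq nR(D)$.
   Context: General setting: $A$ and $\hat A$ are Polish spaces with Borel $\sigma$-algebras ${\cal A},\hat{\cal A}$; $\mathbb P$ is a probability measure on $(A^{\mathbb N},{\cal A}^{\mathbb N})$, $\{X_n\}$ is a process with law $\mathbb P$, and $P_n$ is the law of $X_1^n=(X_1,\dots,X_n)$. $\mathbb P$ is stationary if $X_1^n$ and $X_{1+k}^{n+k}$ have the same law for all $n,k$. $\rho:A\times\hat A\to[0,\infty)$ is measurable and $\rho_n(x_1^n,y_1^n)=\frac1n\sum_{i=1}^n\rho(x_i,y_i)$; $\rho_n(x_1^n,C)=\min_{y_1^n\in C}\rho_n(x_1^n,y_1^n)$ for finite $C$. $M:\hat A\to(0,\infty)$ is measurable with $M(y)\ge M_*$ for a constant $M_*>0$; $M^n(y_1^n)=\prod_iM(y_i)$ and $M^n(C)=\sum_{y_1^n\in C}M^n(y_1^n)$. Relative entropy: $H(\mu\|\nu)=\int\log\frac{d\mu}{d\nu}\,d\mu$ if $\mu\ll\nu$, and $+\infty$ otherwise. For a probability measure $Q_n$ on $\hat A^n$, ${\cal M}_n(P_n,Q_n,D)$ is the set of probability measures $W_n$ on $A^n\times\hat A^n$ with first marginal $P_n$, second marginal $Q_n$, and $\int\rho_n\,dW_n\le D$;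 $I_n(P_n,Q_n,D)=\inf_{W_n\in{\cal M}_n(P_n,Q_n,D)}H(W_n\|P_n\times Q_n)$ ($+\infty$ if empty); $R_n(D)=\inf_{Q_n}\{I_n(P_n,Q_n,D)+E_{Q_n}[\log M^n(Y_1^n)]\}$ over all probability measures $Q_n$ on $\hat A^n$; $R(D)=\lim_{n\to\infty}\frac1nR_n(D)$ when the limit exists. Logarithms are natural. *)

theory Defs
  imports "HOL-Probability.Probability"
begin

(* A^n is modelled as functions nat => 'a restricted (extensional) to {..<n};
   coordinate i (0-based) corresponds to X_{i+1}. *)
abbreviation prodsp :: "nat \<Rightarrow> (nat \<Rightarrow> 'a::topological_space) measure" where
  "prodsp n \<equiv> PiM {..<n} (\<lambda>_. borel)"

definition Pn :: "(nat \<Rightarrow> 'a::topological_space) measure \<Rightarrow> nat \<Rightarrow> (nat \<Rightarrow> 'a) measure" where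
  "Pn P n = distr P (prodsp n) (\<lambda>x. restrict x {..<n})"

definition stationary :: "(nat \<Rightarrow> 'a::topological_space) measure \<Rightarrow> bool" where
  "stationary P \<longleftrightarrow> (\<forall>n k. distr P (prodsp n) (\<lambda>x. \<lambda>i\<in>{..<n}. x (i + k)) = Pn P n)"

definition rho_n :: "('a \<Rightarrow> 'b \<Rightarrow> real) \<Rightarrow> nat \<Rightarrow> (nat \<Rightarrow> 'a) \<Rightarrow> (nat \<Rightarrow> 'b) \<Rightarrow> real" where
  "rho_n rho n x y = (\<Sum>i<n. rho (x i) (y i)) / real n"

definition rho_set :: "('a \<Rightarrow> 'b \<Rightarrow> real) \<Rightarrow> nat \<Rightarrow> (nat \<Rightarrow> 'a) \<Rightarrow> (nat \<Rightarrow> 'b) set \<Rightarrow> real" where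
  "rho_set rho n x C = Min ((\<lambda>y. rho_n rho n x y) ` C)"

definition Mn :: "('b \<Rightarrow> real) \<Rightarrow> nat \<Rightarrow> (nat \<Rightarrow> 'b) \<Rightarrow> real" where
  "Mn M n y = (\<Prod>i<n. M (y i))"

definition MnC :: "('b \<Rightarrow> real) \<Rightarrow> nat \<Rightarrow> (nat \<Rightarrow> 'b) set \<Rightarrow> real" where
  "MnC M n C = (\<Sum>y\<in>C. Mn M n y)"

definition ext_integral :: "'a measure \<Rightarrow> ('a \<Rightarrow> real) \<Rightarrow> ereal" where
  "ext_integral Q g = enn2ereal (\<integral>\<^sup>+ x. ennreal (max 0 (g x)) \<partial>Q)
                      - enn2ereal (\<integral>\<^sup>+ x. ennreal (max 0 (- g x)) \<partial>Q)"

definition rel_entropy :: "'a measure \<Rightarrow> 'a measure \<Rightarrow> ereal" where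
  "rel_entropy mu nu =
     (if absolutely_continuous nu mu \<and> sets mu = sets nu
      then ext_integral mu (\<lambda>x. ln (enn2real (RN_deriv nu mu x)))
      else \<infinity>)"

definition couplings :: "('a \<Rightarrow> 'b \<Rightarrow> real) \<Rightarrow> nat \<Rightarrow> (nat \<Rightarrow> 'a::topological_space) measure
     \<Rightarrow> (nat \<Rightarrow> 'b::topological_space) measure \<Rightarrow> real \<Rightarrow> ((nat \<Rightarrow> 'a) \<times> (nat \<Rightarrow> 'b)) measure set" where
  "couplings rho n P Q D = {W. prob_space W \<and> sets W = sets (prodsp n \<Otimes>\<^sub>M prodsp n)
      \<and> distr W (prodsp n) fst = P \<and> distr W (prodsp n) snd = Q
      \<and> (\<integral>\<^sup>+ w. ennreal (rho_n rho n (fst w) (snd w)) \<partial>W) \<le> ennreal D}"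

definition I_n :: "('a \<Rightarrow> 'b \<Rightarrow> real) \<Rightarrow> nat \<Rightarrow> (nat \<Rightarrow> 'a::topological_space) measure
     \<Rightarrow> (nat \<Rightarrow> 'b::topological_space) measure \<Rightarrow> real \<Rightarrow> ereal" where
  "I_n rho n P Q D = (INF W \<in> couplings rho n P Q D. rel_entropy W (P \<Otimes>\<^sub>M Q))"

definition R_n :: "(nat \<Rightarrow> 'a::topological_space) measure \<Rightarrow> ('a \<Rightarrow> 'b::topological_space \<Rightarrow> real)
     \<Rightarrow> ('b \<Rightarrow> real) \<Rightarrow> nat \<Rightarrow> real \<Rightarrow> ereal" where
  "R_n P rho M n D =
     (INF Q \<in> {Q :: (nat \<Rightarrow> 'b) measure. prob_space Q \<and> sets Q = sets (prodsp n)}.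
        I_n rho n (Pn P n) Q D + ext_integral Q (\<lambda>y. ln (Mn M n y)))"

end

theory Submission
  imports Defs
begin

text \<open>
  For a finite codebook C let \<open>\<phi>\<close> send x to a nearest codeword. Relative to the product of the source
  law and the codeword distribution proportional to M, the law of \<open>(X, \<phi> X)\<close> has density
  \<open>M(C) / M(\<phi> x)\<close> on the graph of \<open>\<phi>\<close>, so the entropy plus the expected log mass is exactly
  \<open>ln M(C)\<close>. Replacing the reference distribution by the true output law only lowers the entropy,
  by Gibbs' inequality.

  For a stationary source, using two channels on consecutive blocks shows that the values R_n(D) are
  subadditive. Some coordinate of the n-block code has average distortion at most D, so R_1(D) is
  finite. Hence all R_n(D) are finite, and Fekete's lemma gives the limit as the infimum of
  R_n(D) / n.
\<close>

section \<open>Relative entropy through densities\<close>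

text \<open>The infimum in \<open>R_n\<close> asks for a coupling whose second marginal is the very
  measure used in the entropy, whereas both constructions below come with a convenient reference
  measure Q instead. They are reconciled by H(W||P x Q) = H(W||P x Q') + H(Q'||Q), where Q' is the
  output law of W. In the concatenation the two source blocks are dependent, so the joint channel is
  not a product of couplings: two conditional densities act on the two pieces of one source word.
  The joint density is still a product, so logarithms add exactly and no inequality for mutual
  information enters. Extended arithmetic stays at the edges: -ln h <= 1/h controls the negative
  part of every log density and M >= Mstar that of the log mass, so real integrals suffice in
  between. Finiteness is brought down to block length 1 because subadditivity would spread the
  finiteness of a single R_n only to multiples of n, too few for a limit.\<close>

lemma ext_integral_eq_integral:
  assumes "integrable Q g"
  shows "ext_integral Q g = ereal (\<integral>x. g x \<partial>Q)"
proof -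
  have pos: "(\<integral>\<^sup>+x. ennreal (max 0 (g x)) \<partial>Q) = ennreal (\<integral>x. max 0 (g x) \<partial>Q)"
    and neg: "(\<integral>\<^sup>+x. ennreal (max 0 (- g x)) \<partial>Q) = ennreal (\<integral>x. max 0 (- g x) \<partial>Q)"
    by (rule nn_integral_eq_integral; use assms in auto)+
  have "(\<integral>x. g x \<partial>Q) = (\<integral>x. max 0 (g x) - max 0 (- g x) \<partial>Q)"
    by (intro Bochner_Integration.integral_cong) auto
  also have "\<dots> = (\<integral>x. max 0 (g x) \<partial>Q) - (\<integral>x. max 0 (- g x) \<partial>Q)"
    using assms by (intro Bochner_Integration.integral_diff) auto
  finally show ?thesis
    unfolding ext_integral_def pos neg by (simp add: enn2ereal_ennreal)
qed

lemma integrable_of_ext_integral: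
  assumes [measurable]: "g \<in> borel_measurable Q"
    and neg: "(\<integral>\<^sup>+x. ennreal (max 0 (- g x)) \<partial>Q) < \<infinity>"
    and ext: "ext_integral Q g < \<infinity>"
  shows "integrable Q g"
proof -
  \<comment> \<open>In \<open>ereal\<close>, infinity minus anything is infinity, even infinity
    minus infinity. A value below infinity therefore rules out an infinite positive part.\<close>
  have "enn2ereal (\<integral>\<^sup>+x. ennreal (max 0 (g x)) \<partial>Q) \<noteq> \<infinity>"
    using ext unfolding ext_integral_def by auto
  then have pos: "(\<integral>\<^sup>+x. ennreal (max 0 (g x)) \<partial>Q) < \<infinity>"
    by (auto simp: less_top infinity_ennreal_def)
  have "(\<integral>\<^sup>+x. ennreal (norm (g x)) \<partial>Q)
      = (\<integral>\<^sup>+x. ennreal (max 0 (g x)) + ennreal (max 0 (- g x)) \<partial>Q)"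
    by (intro nn_integral_cong) (auto simp: max_def abs_if simp flip: ennreal_plus)
  also have "\<dots> = (\<integral>\<^sup>+x. ennreal (max 0 (g x)) \<partial>Q) + (\<integral>\<^sup>+x. ennreal (max 0 (- g x)) \<partial>Q)"
    by (intro nn_integral_add) auto
  also have "\<dots> < \<infinity>" using pos neg by simp
  finally show ?thesis by (intro integrableI_bounded) auto
qed

section \<open>Estimates for the logarithm of one fixed density\<close>

context
  fixes nu W :: "'x measure" and h :: "'x \<Rightarrow> real"
  assumes nu: "prob_space nu" and W: "prob_space W"
    and h [measurable]: "h \<in> borel_measurable nu"
    and h_nonneg: "\<And>x. 0 \<le> h x"
    and W_eq: "W = density nu (\<lambda>x. ennreal (h x))"
begin

lemma density_measurable_W [measurable]: "h \<in> borel_measurable W"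
  unfolding W_eq by simp

lemma AE_density_pos: "AE x in W. 0 < h x"
  unfolding W_eq by (subst AE_density) (auto simp: ennreal_less_zero_iff)

text \<open>The integral is the \<open>nu\<close>-mass of the set where \<open>h\<close> is
  positive: as \<open>1 / 0 = 0\<close>, the product \<open>h x * (1 / h x)\<close> is 1 there and 0
  elsewhere.\<close>

lemma nn_integral_inverse_density_le_1: "(\<integral>\<^sup>+x. ennreal (1 / h x) \<partial>W) \<le> 1"
proof -
  have "(\<integral>\<^sup>+x. ennreal (1 / h x) \<partial>W) = (\<integral>\<^sup>+x. ennreal (h x) * ennreal (1 / h x) \<partial>nu)"
    unfolding W_eq by (rule nn_integral_density) auto
  also have "\<dots> \<le> (\<integral>\<^sup>+x. 1 \<partial>nu)"
    by (intro nn_integral_mono) (use h_nonneg in \<open>simp flip: ennreal_mult\<close>)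
  also have "\<dots> = 1" using prob_space.emeasure_space_1[OF nu] by simp
  finally show ?thesis .
qed

lemma integrable_inverse_density: "integrable W (\<lambda>x. 1 / h x)"
  using nn_integral_inverse_density_le_1 h_nonneg
  by (intro integrableI_nonneg) (auto simp: less_top[symmetric] top_unique)

lemma integral_inverse_density_le_1: "(\<integral>x. 1 / h x \<partial>W) \<le> 1"
proof -
  have "ennreal (\<integral>x. 1 / h x \<partial>W) \<le> 1"
    using nn_integral_inverse_density_le_1 integrable_inverse_density h_nonneg
    by (subst nn_integral_eq_integral[symmetric]) auto
  then show ?thesis by simp
qed

text \<open>From ln t <= t at t = 1/h. No assumption on the entropy is made, so relative entropy
  against a probability measure never takes the form infinity minus infinity.\<close>

lemma integrable_neg_ln_density: "integrable W (\<lambda>x. max 0 (- ln (h x)))"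
proof (rule Bochner_Integration.integrable_bound[OF integrable_inverse_density])
  show "AE x in W. norm (max 0 (- ln (h x))) \<le> norm (1 / h x)"
    using AE_density_pos
  proof eventually_elim
    case (elim x)
    then have "ln (1 / h x) \<le> 1 / h x" using ln_bound[of "1 / h x"] by simp
    with elim show ?case by (auto simp: ln_div)
  qed
qed simp

lemma nn_integral_neg_ln_density: "(\<integral>\<^sup>+x. ennreal (max 0 (- ln (h x))) \<partial>W) < \<infinity>"
  using integrable_neg_ln_density by (simp add: integrable_iff_bounded)

text \<open>Integrate \<open>1 - 1 / h x \<le> ln (h x)\<close>; the left side has nonnegative mean
  because the inverse density has mean at most 1.\<close>

lemma gibbs_inequality:
  assumes "integrable W (\<lambda>x. ln (h x))"
  shows "0 \<le> (\<integral>x. ln (h x) \<partial>W)"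
proof -
  interpret W: prob_space W by (fact W)
  have "0 \<le> (\<integral>x. 1 - 1 / h x \<partial>W)"
    using integrable_inverse_density integral_inverse_density_le_1
    by (simp add: W.prob_space)
  also have "\<dots> \<le> (\<integral>x. ln (h x) \<partial>W)"
  proof (rule integral_mono_AE)
    show "AE x in W. 1 - 1 / h x \<le> ln (h x)"
      using AE_density_pos
    proof eventually_elim
      case (elim x)
      then show ?case using ln_le_minus_one[of "1 / h x"] by (simp add: ln_div)
    qed
  qed (use assms integrable_inverse_density in auto)
  finally show ?thesis .
qed

text \<open>\<open>RN_deriv\<close> is determined only up to \<open>nu\<close>-null sets. These are
  null for \<open>W\<close> as well, so neither part of \<open>ext_integral\<close> sees the
  difference from \<open>h\<close>.\<close>

lemma rel_entropy_density: "rel_entropy W nu = ext_integral W (\<lambda>x. ln (h x))"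
proof -
  interpret nu: prob_space nu by (fact nu)
  have ac: "absolutely_continuous nu W" "sets W = sets nu"
    unfolding W_eq by (auto intro!: absolutely_continuousI_density)
  have "AE x in nu. ennreal (h x) = RN_deriv nu W x"
    using W_eq by (intro nu.RN_deriv_unique) auto
  then have "AE x in nu. ln (enn2real (RN_deriv nu W x)) = ln (h x)"
  proof eventually_elim
    case (elim x)
    then show ?case by (metis enn2real_ennreal h_nonneg)
  qed
  then have ae: "AE x in W. ln (enn2real (RN_deriv nu W x)) = ln (h x)"
    unfolding W_eq by (subst AE_density) auto
  have "(\<integral>\<^sup>+x. ennreal (max 0 (ln (enn2real (RN_deriv nu W x)))) \<partial>W)
      = (\<integral>\<^sup>+x. ennreal (max 0 (ln (h x))) \<partial>W)"
    "(\<integral>\<^sup>+x. ennreal (max 0 (- ln (enn2real (RN_deriv nu W x)))) \<partial>W)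
      = (\<integral>\<^sup>+x. ennreal (max 0 (- ln (h x))) \<partial>W)"
    by (intro nn_integral_cong_AE; use ae in eventually_elim; simp)+
  with ac show ?thesis by (simp add: rel_entropy_def ext_integral_def)
qed

end

text \<open>Extracts real-valued data from a finite entropy. Absolute continuity follows because
  \<open>rel_entropy\<close> is infinite otherwise, and the derivative is finite almost everywhere
  because \<open>W\<close> is a finite measure, so \<open>enn2real\<close> loses nothing.\<close>

lemma rel_entropy_finiteE:
  assumes nu: "prob_space nu" and W: "prob_space W" and fin: "rel_entropy W nu < \<infinity>"
  obtains h where "h \<in> borel_measurable nu" "\<And>x. 0 \<le> h x"
    "W = density nu (\<lambda>x. ennreal (h x))" "integrable W (\<lambda>x. ln (h x))"
    "rel_entropy W nu = ereal (\<integral>x. ln (h x) \<partial>W)"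
proof -
  interpret nu: prob_space nu by (fact nu)
  interpret W: prob_space W by (fact W)
  from fin have ac: "absolutely_continuous nu W" "sets W = sets nu"
    by (auto simp: rel_entropy_def split: if_splits)
  define h where "h x = enn2real (RN_deriv nu W x)" for x
  have [measurable]: "h \<in> borel_measurable nu" unfolding h_def by measurable
  have "AE x in nu. RN_deriv nu W x \<noteq> \<infinity>"
    by (rule nu.RN_deriv_finite[OF _ ac]) (rule W.sigma_finite_measure_axioms)
  then have "density nu (\<lambda>x. ennreal (h x)) = density nu (RN_deriv nu W)"
    by (intro density_cong) (auto simp: h_def less_top)
  then have W_eq: "W = density nu (\<lambda>x. ennreal (h x))"
    using nu.density_RN_deriv[OF ac] by simp
  have h0: "\<And>x. 0 \<le> h x" by (simp add: h_def)
  have re: "rel_entropy W nu = ext_integral W (\<lambda>x. ln (h x))"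
    by (rule rel_entropy_density[OF nu W _ h0 W_eq]) simp
  have "h \<in> borel_measurable W" using ac(2) by (simp cong: measurable_cong_sets)
  then have int: "integrable W (\<lambda>x. ln (h x))"
    using fin re nn_integral_neg_ln_density[OF nu W _ h0 W_eq]
    by (intro integrable_of_ext_integral) auto
  show ?thesis
    using that[of h] W_eq h0 int re ext_integral_eq_integral[OF int] by simp
qed

text \<open>If \<open>r\<close> is the density of the output law against \<open>Q\<close>, then h /
  r is the density of \<open>W\<close> against the new product. Its logarithm integrates to that of
  \<open>h\<close> minus the entropy of the output law against \<open>Q\<close>, which Gibbs'
  inequality makes nonnegative. The work lies in showing that these integrals exist
  separately.\<close>

lemma rel_entropy_snd_marginal_le:
  fixes p :: "'x measure" and Q :: "'y measure" and h :: "'x \<times> 'y \<Rightarrow> real"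
  assumes p: "prob_space p" and Q: "prob_space Q"
    and h [measurable]: "h \<in> borel_measurable (p \<Otimes>\<^sub>M Q)"
    and h_nonneg: "\<And>w. 0 \<le> h w"
    and W_eq: "W = density (p \<Otimes>\<^sub>M Q) (\<lambda>w. ennreal (h w))"
    and W: "prob_space W"
    and int_h: "integrable W (\<lambda>w. ln (h w))"
  shows "rel_entropy W (p \<Otimes>\<^sub>M distr W Q snd) \<le> ereal (\<integral>w. ln (h w) \<partial>W)"
proof -
  interpret p: prob_space p by (fact p)
  interpret Q: prob_space Q by (fact Q)
  interpret pQ: pair_prob_space p Q ..
  interpret W: prob_space W by (fact W)
  have sets_W [measurable_cong]: "sets W = sets (p \<Otimes>\<^sub>M Q)" by (simp add: W_eq)
  have snd_W [measurable]: "snd \<in> measurable W Q" by measurable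
  define Q' where "Q' = distr W Q snd"
  have Q': "prob_space Q'" unfolding Q'_def by (rule W.prob_space_distr) measurable
  interpret Q': prob_space Q' by (fact Q')
  interpret pQ': pair_prob_space p Q' ..
  have sets_Q' [measurable_cong]: "sets Q' = sets Q" by (simp add: Q'_def)
  define q where "q y = (\<integral>\<^sup>+x. ennreal (h (x, y)) \<partial>p)" for y
  have q [measurable]: "q \<in> borel_measurable Q" unfolding q_def by measurable
  have Q'_q: "Q' = density Q q"
  proof (rule measure_eqI)
    fix A assume A: "A \<in> sets Q'"
    then have A' [measurable]: "A \<in> sets Q" by (simp add: sets_Q')
    have "emeasure Q' A = (\<integral>\<^sup>+y. indicator A y \<partial>Q')" using A by simp
    also have "\<dots> = (\<integral>\<^sup>+w. indicator A (snd w) \<partial>W)"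
      unfolding Q'_def by (rule nn_integral_distr) auto
    also have "\<dots> = (\<integral>\<^sup>+w. ennreal (h w) * indicator A (snd w) \<partial>(p \<Otimes>\<^sub>M Q))"
      unfolding W_eq by (rule nn_integral_density) auto
    also have "\<dots> = (\<integral>\<^sup>+y. (\<integral>\<^sup>+x. ennreal (h (x, y)) * indicator A y \<partial>p) \<partial>Q)"
      by (subst pQ.nn_integral_snd[symmetric]) auto
    also have "\<dots> = (\<integral>\<^sup>+y. q y * indicator A y \<partial>Q)"
      unfolding q_def by (intro nn_integral_cong nn_integral_multc) auto
    also have "\<dots> = emeasure (density Q q) A" by (simp add: emeasure_density)
    finally show "emeasure Q' A = emeasure (density Q q) A" .
  qed (simp add: sets_Q')
  have "(\<integral>\<^sup>+y. q y \<partial>Q) = 1"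
    using Q'.emeasure_space_1 unfolding Q'_q by (simp add: emeasure_density cong: nn_integral_cong)
  then have q_fin: "AE y in Q. q y \<noteq> \<infinity>"
    by (intro nn_integral_noteq_infinite) auto
  define r where "r y = enn2real (q y)" for y
  have r [measurable]: "r \<in> borel_measurable Q" unfolding r_def by measurable
  have r0: "0 \<le> r y" for y by (simp add: r_def)
  have Q'_r: "Q' = density Q (\<lambda>y. ennreal (r y))"
    unfolding Q'_q using q_fin by (intro density_cong) (auto simp: r_def less_top)
  have "AE y in Q'. 0 < r y" by (rule AE_density_pos[OF Q Q' r r0 Q'_r])
  then have r_pos: "AE w in W. 0 < r (snd w)"
    unfolding Q'_def by (rule AE_distrD[OF snd_W])
  \<comment> \<open>\<open>k\<close> divides by \<open>r\<close> and is 0 by convention where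
    \<open>r\<close> vanishes; this agrees with \<open>W\<close> only if \<open>h\<close> vanishes
    there too.\<close>
  then have r_pos': "AE w in p \<Otimes>\<^sub>M Q. 0 < h w \<longrightarrow> 0 < r (snd w)"
    unfolding W_eq by (subst (asm) AE_density) (auto simp: ennreal_less_zero_iff)
  have h_pos: "AE w in W. 0 < h w"
    by (rule AE_density_pos[OF pQ.prob_space_axioms W h h_nonneg W_eq])
  define k where "k w = h w / r (snd w)" for w
  have k [measurable]: "k \<in> borel_measurable (p \<Otimes>\<^sub>M Q)" unfolding k_def by measurable
  have k0: "0 \<le> k w" for w using h_nonneg r0 by (simp add: k_def)
  have "p \<Otimes>\<^sub>M Q' = density p (\<lambda>_. 1) \<Otimes>\<^sub>M density Q (\<lambda>y. ennreal (r y))"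
    by (simp add: density_1 flip: Q'_r)
  also have "\<dots> = density (p \<Otimes>\<^sub>M Q) (\<lambda>w. ennreal (r (snd w)))"
    using Q'.sigma_finite_measure_axioms
    by (subst pair_measure_density) (auto simp: Q.sigma_finite_measure_axioms split_beta' simp flip: Q'_r)
  finally have pQ'_eq: "p \<Otimes>\<^sub>M Q' = density (p \<Otimes>\<^sub>M Q) (\<lambda>w. ennreal (r (snd w)))" .
  have "density (p \<Otimes>\<^sub>M Q') (\<lambda>w. ennreal (k w))
      = density (p \<Otimes>\<^sub>M Q) (\<lambda>w. ennreal (r (snd w)) * ennreal (k w))"
    unfolding pQ'_eq by (rule density_density_eq) auto
  also have "\<dots> = W" unfolding W_eq
  proof (rule density_cong)
    show "AE w in p \<Otimes>\<^sub>M Q. ennreal (r (snd w)) * ennreal (k w) = ennreal (h w)"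
      using r_pos'
    proof eventually_elim
      case (elim w)
      then show ?case using h_nonneg[of w] r0[of "snd w"]
        by (cases "0 < h w") (auto simp: k_def simp flip: ennreal_mult)
    qed
  qed auto
  finally have W_k: "W = density (p \<Otimes>\<^sub>M Q') (\<lambda>w. ennreal (k w))" by simp
  have k' [measurable]: "k \<in> borel_measurable (p \<Otimes>\<^sub>M Q')" by measurable
  have neg_k: "integrable W (\<lambda>w. max 0 (- ln (k w)))"
    by (rule integrable_neg_ln_density[OF pQ'.prob_space_axioms W k' k0 W_k])
  have "integrable Q' (\<lambda>y. max 0 (- ln (r y)))"
    by (rule integrable_neg_ln_density[OF Q Q' r r0 Q'_r])
  then have neg_r: "integrable W (\<lambda>w. max 0 (- ln (r (snd w))))"
    unfolding Q'_def by (rule integrable_distr[OF snd_W])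
  have ln_k: "AE w in W. ln (k w) = ln (h w) - ln (r (snd w))"
    using h_pos r_pos by eventually_elim (simp add: k_def ln_div)
  \<comment> \<open>The negative part of \<open>ln r\<close> is integrable as that of a log density.
    The positive part is bounded through ln r = ln h - ln k, since \<open>k\<close> is a density too
    and the negative part of \<open>ln k\<close> is integrable.\<close>
  have int_r: "integrable W (\<lambda>w. ln (r (snd w)))"
  proof (rule Bochner_Integration.integrable_bound)
    show "integrable W (\<lambda>w. max 0 (- ln (r (snd w))) + \<bar>ln (h w)\<bar> + max 0 (- ln (k w)))"
      using neg_r int_h neg_k by auto
    show "AE w in W. norm (ln (r (snd w)))
        \<le> norm (max 0 (- ln (r (snd w))) + \<bar>ln (h w)\<bar> + max 0 (- ln (k w)))"
      using ln_k by eventually_elim auto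
  qed measurable
  have "integrable W (\<lambda>w. ln (h w) - ln (r (snd w)))" using int_h int_r by auto
  then have int_k: "integrable W (\<lambda>w. ln (k w))"
    by (subst integrable_cong_AE[OF _ _ ln_k]) auto
  have int_r': "integrable Q' (\<lambda>y. ln (r y))"
    using int_r unfolding Q'_def by (subst integrable_distr_eq) auto
  have "(\<integral>w. ln (k w) \<partial>W) = (\<integral>w. ln (h w) - ln (r (snd w)) \<partial>W)"
    by (rule integral_cong_AE[OF _ _ ln_k]) auto
  also have "\<dots> = (\<integral>w. ln (h w) \<partial>W) - (\<integral>w. ln (r (snd w)) \<partial>W)"
    using int_h int_r by (rule Bochner_Integration.integral_diff)
  also have "(\<integral>w. ln (r (snd w)) \<partial>W) = (\<integral>y. ln (r y) \<partial>Q')"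
    unfolding Q'_def by (subst integral_distr) auto
  also have "(\<integral>w. ln (h w) \<partial>W) - (\<integral>y. ln (r y) \<partial>Q') \<le> (\<integral>w. ln (h w) \<partial>W)"
    using gibbs_inequality[OF Q Q' r r0 Q'_r int_r'] by simp
  finally have "(\<integral>w. ln (k w) \<partial>W) \<le> (\<integral>w. ln (h w) \<partial>W)" .
  then show ?thesis
    using rel_entropy_density[OF pQ'.prob_space_axioms W k' k0 W_k]
      ext_integral_eq_integral[OF int_k] by (simp add: Q'_def)
qed

section \<open>Test channels\<close>

locale rate_distortion =
  fixes P :: "(nat \<Rightarrow> 'a::polish_space) measure"
    and rho :: "'a \<Rightarrow> 'b::polish_space \<Rightarrow> real"
    and M :: "'b \<Rightarrow> real" and Mstar :: real
  assumes P_prob: "prob_space P"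
    and P_sets: "sets P = sets (PiM (UNIV :: nat set) (\<lambda>_. (borel :: 'a measure)))"
    and rho_meas: "(\<lambda>(x, y). rho x y) \<in> borel_measurable (borel \<Otimes>\<^sub>M borel)"
    and rho_nonneg: "\<And>x y. 0 \<le> rho x y"
    and M_meas [measurable]: "M \<in> borel_measurable borel"
    and Mstar_pos: "0 < Mstar" and M_ge: "\<And>y. Mstar \<le> M y"
begin

lemma M_pos: "0 < M y"
  using Mstar_pos M_ge[of y] by linarith

lemma sets_P [measurable_cong]: "sets P = sets (PiM UNIV (\<lambda>_. borel))"
  by (fact P_sets)

lemma sets_Pn [measurable_cong, simp]: "sets (Pn P n) = sets (prodsp n)"
  by (simp add: Pn_def)

lemma space_Pn [simp]: "space (Pn P n) = space (prodsp n)"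
  by (rule sets_eq_imp_space_eq) simp

lemma prob_space_Pn: "prob_space (Pn P n)"
  unfolding Pn_def by (rule prob_space.prob_space_distr[OF P_prob]) measurable

lemma rho_measurable [measurable (raw)]:
  assumes "f \<in> measurable N borel" "g \<in> measurable N borel"
  shows "(\<lambda>x. rho (f x) (g x)) \<in> borel_measurable N"
  using measurable_compose[OF measurable_Pair[OF assms] rho_meas] by simp

lemma rho_n_measurable [measurable (raw)]:
  assumes [measurable]: "f \<in> measurable N (prodsp n)" "g \<in> measurable N (prodsp n)"
  shows "(\<lambda>x. rho_n rho n (f x) (g x)) \<in> borel_measurable N"
  unfolding rho_n_def by measurable

lemma Mn_measurable [measurable]: "Mn M n \<in> borel_measurable (prodsp n)"
  unfolding Mn_def by measurable

lemma Mn_pos: "0 < Mn M n y"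
  unfolding Mn_def by (intro prod_pos) (simp add: M_pos)

lemma rho_n_nonneg: "0 \<le> rho_n rho n x y"
  unfolding rho_n_def by (simp add: sum_nonneg rho_nonneg)

lemma ln_Mn_ge: "real n * ln Mstar \<le> ln (Mn M n y)"
proof -
  have "Mstar ^ n \<le> Mn M n y"
    using prod_mono[of "{..<n}" "\<lambda>_. Mstar" "\<lambda>i. M (y i)"] M_ge Mstar_pos
    by (simp add: Mn_def less_imp_le)
  then show ?thesis
    using Mstar_pos by (metis ln_mono ln_realpow zero_less_power)
qed

text \<open>The reference measure Q need not be the output law of the channel W: by rel_entropy_snd_marginal_le,
  passing to the output law can only lower the relative entropy.\<close>

definition test_channel where
  "test_channel n D Q h W \<longleftrightarrow>
     prob_space Q \<and> sets Q = sets (prodsp n) \<and>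
     h \<in> borel_measurable (prodsp n \<Otimes>\<^sub>M prodsp n) \<and> (\<forall>w. 0 \<le> h w) \<and>
     W = density (Pn P n \<Otimes>\<^sub>M Q) (\<lambda>w. ennreal (h w)) \<and>
     distr W (prodsp n) fst = Pn P n \<and>
     (\<integral>\<^sup>+w. ennreal (rho_n rho n (fst w) (snd w)) \<partial>W) \<le> ennreal D \<and>
     integrable W (\<lambda>w. ln (h w)) \<and> integrable W (\<lambda>w. ln (Mn M n (snd w)))"

text \<open>For a test channel this is the objective of \<open>R_n\<close> with the entropy taken
  against the reference measure, hence an upper bound for the objective at the output law.\<close>

definition cost where
  "cost n h W = (\<integral>w. ln (h w) \<partial>W) + (\<integral>w. ln (Mn M n (snd w)) \<partial>W)"

lemma test_channel_sets:
  assumes "test_channel n D Q h W"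
  shows "sets W = sets (prodsp n \<Otimes>\<^sub>M prodsp n)"
proof -
  have "sets (Pn P n \<Otimes>\<^sub>M Q) = sets (prodsp n \<Otimes>\<^sub>M prodsp n)"
    using assms by (intro sets_pair_measure_cong) (auto simp: test_channel_def)
  with assms show ?thesis by (simp add: test_channel_def)
qed

lemma test_channel_prob:
  assumes "test_channel n D Q h W"
  shows "prob_space W"
proof (rule prob_space_distrD[where N = "prodsp n"])
  note [measurable_cong] = test_channel_sets[OF assms]
  show "fst \<in> measurable W (prodsp n)" by measurable
  show "prob_space (distr W (prodsp n) fst)"
    using assms prob_space_Pn by (auto simp: test_channel_def)
qed

text \<open>The competitor in the infimum is the output law of \<open>W\<close>: with it,
  \<open>W\<close> becomes an admissible coupling.\<close>

lemma R_n_le_cost: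
  assumes tc: "test_channel n D Q h W"
  shows "R_n P rho M n D \<le> ereal (cost n h W)"
proof -
  note sets_W [measurable_cong] = test_channel_sets[OF tc]
  interpret W: prob_space W by (rule test_channel_prob[OF tc])
  from tc have Q: "prob_space Q" and sets_Q [measurable_cong]: "sets Q = sets (prodsp n)"
    and h [measurable]: "h \<in> borel_measurable (prodsp n \<Otimes>\<^sub>M prodsp n)" and h0: "\<And>w. 0 \<le> h w"
    and W_eq: "W = density (Pn P n \<Otimes>\<^sub>M Q) (\<lambda>w. ennreal (h w))"
    and int: "integrable W (\<lambda>w. ln (h w))" "integrable W (\<lambda>w. ln (Mn M n (snd w)))"
    and fst_W: "distr W (prodsp n) fst = Pn P n"
    and dist: "(\<integral>\<^sup>+w. ennreal (rho_n rho n (fst w) (snd w)) \<partial>W) \<le> ennreal D"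
    by (auto simp: test_channel_def)
  define Q' where "Q' = distr W (prodsp n) snd"
  have Q': "prob_space Q'" "sets Q' = sets (prodsp n)"
    unfolding Q'_def by (auto intro!: W.prob_space_distr)
  have "Q' = distr W Q snd" unfolding Q'_def by (rule distr_cong) (auto simp: sets_Q)
  then have "rel_entropy W (Pn P n \<Otimes>\<^sub>M Q') \<le> ereal (\<integral>w. ln (h w) \<partial>W)"
    using rel_entropy_snd_marginal_le[OF prob_space_Pn Q _ h0 W_eq W.prob_space_axioms int(1)]
    by simp
  moreover have "W \<in> couplings rho n (Pn P n) Q' D"
    unfolding couplings_def using W.prob_space_axioms sets_W fst_W dist Q'_def by blast
  ultimately have I: "I_n rho n (Pn P n) Q' D \<le> ereal (\<integral>w. ln (h w) \<partial>W)"
    unfolding I_n_def by (intro INF_lower2[of W])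
  have "integrable Q' (\<lambda>y. ln (Mn M n y))"
    using int(2) unfolding Q'_def by (subst integrable_distr_eq) auto
  then have "ext_integral Q' (\<lambda>y. ln (Mn M n y)) = ereal (\<integral>y. ln (Mn M n y) \<partial>Q')"
    by (rule ext_integral_eq_integral)
  also have "(\<integral>y. ln (Mn M n y) \<partial>Q') = (\<integral>w. ln (Mn M n (snd w)) \<partial>W)"
    unfolding Q'_def by (subst integral_distr) auto
  finally have "I_n rho n (Pn P n) Q' D + ext_integral Q' (\<lambda>y. ln (Mn M n y)) \<le> ereal (cost n h W)"
    using add_right_mono[OF I] by (simp add: cost_def flip: plus_ereal.simps(1))
  then show ?thesis
    unfolding R_n_def using Q' by (intro INF_lower2[where i = Q']) auto
qed

text \<open>The converse passage, with the output law itself as reference measure. The bound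
  \<open>Mstar\<close> keeps the negative part of the log mass finite, so its expectation is an
  honest integral.\<close>

lemma R_n_lessE:
  assumes less: "R_n P rho M n D < ereal r"
  obtains Q h W where "test_channel n D Q h W" "cost n h W < r"
proof -
  from less obtain Q where Q: "prob_space Q" and sets_Q [measurable_cong]: "sets Q = sets (prodsp n)"
    and r: "I_n rho n (Pn P n) Q D + ext_integral Q (\<lambda>y. ln (Mn M n y)) < ereal r"
    unfolding R_n_def INF_less_iff by auto
  interpret Q: prob_space Q by (fact Q)
  have "(\<integral>\<^sup>+y. ennreal (max 0 (- ln (Mn M n y))) \<partial>Q) \<le> (\<integral>\<^sup>+y. ennreal \<bar>real n * ln Mstar\<bar> \<partial>Q)"
    using ln_Mn_ge[of n] by (intro nn_integral_mono ennreal_leI) (smt (verit))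
  also have "\<dots> < \<infinity>" by (simp add: Q.emeasure_space_1)
  finally have neg: "(\<integral>\<^sup>+y. ennreal (max 0 (- ln (Mn M n y))) \<partial>Q) < \<infinity>" .
  \<comment> \<open>In \<open>ereal\<close> a summand plus infinity makes the sum infinite, whatever
    the other summand is, so both lie below infinity.\<close>
  have "ext_integral Q (\<lambda>y. ln (Mn M n y)) < \<infinity>" using r by auto
  then have int_M: "integrable Q (\<lambda>y. ln (Mn M n y))"
    using neg by (intro integrable_of_ext_integral) auto
  define e where "e = (\<integral>y. ln (Mn M n y) \<partial>Q)"
  have e: "ext_integral Q (\<lambda>y. ln (Mn M n y)) = ereal e"
    unfolding e_def by (rule ext_integral_eq_integral[OF int_M])
  have "I_n rho n (Pn P n) Q D < ereal (r - e)"
    using r unfolding e by (cases "I_n rho n (Pn P n) Q D") auto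
  then obtain W where W: "W \<in> couplings rho n (Pn P n) Q D"
    and re: "rel_entropy W (Pn P n \<Otimes>\<^sub>M Q) < ereal (r - e)"
    unfolding I_n_def INF_less_iff by auto
  from W have W_prob: "prob_space W"
    and sets_W [measurable_cong]: "sets W = sets (prodsp n \<Otimes>\<^sub>M prodsp n)"
    and snd_W: "distr W (prodsp n) snd = Q" by (auto simp: couplings_def)
  interpret Pn: prob_space "Pn P n" by (rule prob_space_Pn)
  interpret PQ: pair_prob_space "Pn P n" Q ..
  from re have "rel_entropy W (Pn P n \<Otimes>\<^sub>M Q) < \<infinity>" by auto
  then obtain h where h: "h \<in> borel_measurable (Pn P n \<Otimes>\<^sub>M Q)" "\<And>w. 0 \<le> h w"
    "W = density (Pn P n \<Otimes>\<^sub>M Q) (\<lambda>w. ennreal (h w))" "integrable W (\<lambda>w. ln (h w))"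
    "rel_entropy W (Pn P n \<Otimes>\<^sub>M Q) = ereal (\<integral>w. ln (h w) \<partial>W)"
    using rel_entropy_finiteE[OF PQ.prob_space_axioms W_prob] by blast
  have h_meas: "h \<in> borel_measurable (prodsp n \<Otimes>\<^sub>M prodsp n)" using h(1) by measurable
  have "integrable (distr W (prodsp n) snd) (\<lambda>y. ln (Mn M n y))" using int_M snd_W by simp
  then have int_M': "integrable W (\<lambda>w. ln (Mn M n (snd w)))"
    by (subst (asm) integrable_distr_eq) auto
  have "e = (\<integral>w. ln (Mn M n (snd w)) \<partial>W)"
    unfolding e_def snd_W[symmetric] by (subst integral_distr) auto
  then have "cost n h W < r" using re h(5) by (simp add: cost_def)
  moreover have "test_channel n D Q h W"
    unfolding test_channel_def using W Q sets_Q h h_meas int_M' by (auto simp: couplings_def)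
  ultimately show ?thesis using that by blast
qed

text \<open>Entropy is nonnegative and each letter contributes at least \<open>ln Mstar\<close>.
  This excludes minus infinity and supplies the linear lower bound that Fekete's lemma asks
  for.\<close>

lemma R_n_ge: "ereal (real n * ln Mstar) \<le> R_n P rho M n D"
proof (rule ccontr)
  assume "\<not> ?thesis"
  then have "R_n P rho M n D < ereal (real n * ln Mstar)" by simp
  then obtain Q h W where tc: "test_channel n D Q h W" and c: "cost n h W < real n * ln Mstar"
    by (rule R_n_lessE)
  interpret W: prob_space W by (rule test_channel_prob[OF tc])
  interpret Pn: prob_space "Pn P n" by (rule prob_space_Pn)
  from tc have Q: "prob_space Q" and sets_Q [measurable_cong]: "sets Q = sets (prodsp n)"
    and h [measurable]: "h \<in> borel_measurable (prodsp n \<Otimes>\<^sub>M prodsp n)" and h0: "\<And>w. 0 \<le> h w"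
    and W_eq: "W = density (Pn P n \<Otimes>\<^sub>M Q) (\<lambda>w. ennreal (h w))"
    and int: "integrable W (\<lambda>w. ln (h w))" "integrable W (\<lambda>w. ln (Mn M n (snd w)))"
    by (auto simp: test_channel_def)
  interpret Q: prob_space Q by (fact Q)
  interpret PQ: pair_prob_space "Pn P n" Q ..
  have "0 \<le> (\<integral>w. ln (h w) \<partial>W)"
    using gibbs_inequality[OF PQ.prob_space_axioms W.prob_space_axioms _ h0 W_eq int(1)] by simp
  moreover have "real n * ln Mstar \<le> (\<integral>w. ln (Mn M n (snd w)) \<partial>W)"
    using integral_mono[OF _ int(2), of "\<lambda>_. real n * ln Mstar"] ln_Mn_ge
    by (simp add: W.prob_space)
  ultimately show False using c by (simp add: cost_def)
qed

end

section \<open>Fekete's lemma\<close>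

text \<open>The linear lower bound makes the infimum of the quotients a real number. Indices start
  at 1, since nothing is known about \<open>a 0\<close>.\<close>

lemma fekete:
  fixes a :: "nat \<Rightarrow> real"
  assumes sub: "\<And>m n. 1 \<le> m \<Longrightarrow> 1 \<le> n \<Longrightarrow> a (m + n) \<le> a m + a n"
    and lower: "\<And>n. 1 \<le> n \<Longrightarrow> real n * c \<le> a n"
  shows "\<exists>L. (\<lambda>n. a n / real n) \<longlonglongrightarrow> L \<and> (\<forall>n\<ge>1. real n * L \<le> a n)"
proof -
  define L where "L = (INF n\<in>{1..}. a n / real n)"
  have "bdd_below ((\<lambda>n. a n / real n) ` {1..})"
    using lower by (intro bdd_belowI[of _ c]) (auto simp: field_simps)
  then have L_le: "L \<le> a n / real n" if "1 \<le> n" for n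
    unfolding L_def using that by (intro cINF_lower) auto
  have "eventually (\<lambda>n. a n / real n < u) sequentially" if "L < u" for u
  proof -
    have "\<exists>v\<in>(\<lambda>n. a n / real n) ` {1..}. v < u"
      by (rule cInf_lessD) (use that in \<open>auto simp: L_def\<close>)
    then obtain k where k: "1 \<le> k" "a k / real k < u" by auto
    \<comment> \<open>This replaces division with remainder: once the line of slope
      \<open>a k / k\<close> is subtracted, a shift by \<open>k\<close> no longer increases the
      sequence, so its values on \<open>{1..k}\<close> bound all later ones.\<close>
    define b where "b n = a n - real n * (a k / real k)" for n
    define B where "B = Max (b ` {1..k})"
    have b_period: "b (n + k) \<le> b n" if "1 \<le> n" for n
    proof -
      have "real (n + k) * (a k / real k) = real n * (a k / real k) + a k"
        using k(1) by (simp add: field_simps)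
      with sub[OF that k(1)] show ?thesis by (simp add: b_def)
    qed
    have b_le: "b n \<le> B" if "1 \<le> n" for n
      using that
    proof (induction n rule: less_induct)
      case (less n)
      show ?case
      proof (cases "n \<le> k")
        case True
        with less.prems show ?thesis unfolding B_def by (intro Max_ge) auto
      next
        case False
        then have "b (n - k) \<le> B" using less k(1) by auto
        with b_period[of "n - k"] False show ?thesis by force
      qed
    qed
    have "(\<lambda>n. a k / real k + B / real n) \<longlonglongrightarrow> a k / real k + 0"
      by (intro tendsto_intros lim_const_over_n)
    then have "eventually (\<lambda>n. a k / real k + B / real n < u) sequentially"
      using k(2) by (intro order_tendstoD(2)) auto
    then show ?thesis
      using eventually_ge_at_top[of 1]
    proof eventually_elim
      case (elim n)
      then have "a n / real n \<le> a k / real k + B / real n"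
        using b_le[of n] by (simp add: b_def field_simps)
      with elim show ?case by simp
    qed
  qed
  moreover have "eventually (\<lambda>n. u < a n / real n) sequentially" if "u < L" for u
    using eventually_ge_at_top[of 1] by eventually_elim (use L_le that in force)
  ultimately have "(\<lambda>n. a n / real n) \<longlonglongrightarrow> L" by (intro order_tendstoI)
  moreover have "real n * L \<le> a n" if "1 \<le> n" for n
    using L_le[OF that] that by (simp add: field_simps)
  ultimately show ?thesis by blast
qed

section \<open>The one-block bound\<close>

text \<open>Candidates are added one at a time, and a new one wins when it is at least as good as
  the minimum so far. The selector is thus a nest of finitely many measurable case distinctions,
  which also settles ties.\<close>

lemma measurable_argmin:
  fixes d :: "'x \<Rightarrow> 'c \<Rightarrow> real"
  assumes "finite C" "C \<noteq> {}" "C \<subseteq> space N"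
    and "\<And>c. c \<in> C \<Longrightarrow> (\<lambda>x. d x c) \<in> borel_measurable K"
  shows "\<exists>\<phi>\<in>measurable K N. \<forall>x. \<phi> x \<in> C \<and> d x (\<phi> x) = Min (d x ` C)"
  using assms
proof (induction C rule: finite_ne_induct)
  case (singleton c)
  then show ?case by (intro bexI[of _ "\<lambda>_. c"]) auto
next
  case (insert c C)
  have "C \<subseteq> space N" and meas: "\<And>c'. c' \<in> insert c C \<Longrightarrow> (\<lambda>x. d x c') \<in> borel_measurable K"
    using insert.prems by blast+
  then obtain \<phi> where \<phi> [measurable]: "\<phi> \<in> measurable K N"
    and min: "\<And>x. \<phi> x \<in> C" "\<And>x. d x (\<phi> x) = Min (d x ` C)"
    using insert.IH by blast
  have [measurable]: "(\<lambda>x. d x c) \<in> borel_measurable K" by (rule meas) simp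
  have [measurable]: "(\<lambda>x. Min (d x ` C)) \<in> borel_measurable K"
    by (rule borel_measurable_Min) (use insert.hyps meas in auto)
  have [measurable]: "(\<lambda>_. c) \<in> measurable K N" using insert.prems by auto
  let ?\<psi> = "\<lambda>x. if d x c \<le> Min (d x ` C) then c else \<phi> x"
  have "?\<psi> \<in> measurable K N" by measurable
  moreover have "?\<psi> x \<in> insert c C \<and> d x (?\<psi> x) = Min (d x ` insert c C)" for x
    using insert.hyps min[of x] by (auto simp: min_def)
  ultimately show ?case by (intro bexI[of _ ?\<psi>]) auto
qed

text \<open>A point is a finite box of one-point sets, each closed in a Polish space.\<close>

lemma sets_prodsp_singleton:
  fixes c :: "nat \<Rightarrow> 'b::polish_space"
  assumes "c \<in> space (prodsp n)"
  shows "{c} \<in> sets (prodsp n)"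
proof -
  have "{c} = PiE {..<n} (\<lambda>i. {c i})"
    using assms by (subst PiE_singleton) (auto simp: space_PiM PiE_def)
  then show ?thesis by (auto intro: sets_PiM_I_finite)
qed

context rate_distortion
begin

lemma R_n_le_ln_MnC:
  assumes C: "finite C" "C \<noteq> {}" "C \<subseteq> space (prodsp n)"
    and dist: "(\<integral>\<^sup>+x. ennreal (rho_set rho n x C) \<partial>Pn P n) \<le> ennreal D"
  shows "R_n P rho M n D \<le> ereal (ln (MnC M n C))"
proof -
  define p where "p = Pn P n"
  have sets_p [measurable_cong]: "sets p = sets (prodsp n)" by (simp add: p_def)
  have "(\<lambda>x. rho_n rho n x c) \<in> borel_measurable p" if "c \<in> C" for c
    using that C by (intro rho_n_measurable) auto
  from measurable_argmin[where d = "rho_n rho n", OF C this]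
  obtain \<phi> where \<phi> [measurable]: "\<phi> \<in> measurable p (prodsp n)"
    and \<phi>: "\<forall>x. \<phi> x \<in> C \<and> rho_n rho n x (\<phi> x) = Min (rho_n rho n x ` C)"
    by blast
  then have \<phi>_C: "\<And>x. \<phi> x \<in> C" and \<phi>_min: "\<And>x. rho_n rho n x (\<phi> x) = rho_set rho n x C"
    by (simp_all add: rho_set_def)
  have [measurable]: "{c} \<in> sets (prodsp n)" if "c \<in> C" for c
    using that C by (intro sets_prodsp_singleton) auto
  define S where "S = MnC M n C"
  have S: "0 < S" unfolding S_def MnC_def using C by (intro sum_pos) (auto simp: Mn_pos)
  \<comment> \<open>\<open>point_measure\<close> lives on \<open>C\<close> with every subset
    measurable; its image under the identity puts the same weights on the product
    sigma-algebra.\<close>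
  define Q where "Q = distr (point_measure C (\<lambda>c. ennreal (Mn M n c / S))) (prodsp n) (\<lambda>c. c)"
  have sets_Q [measurable_cong]: "sets Q = sets (prodsp n)" by (simp add: Q_def)
  have id: "(\<lambda>c. c) \<in> measurable (point_measure C (\<lambda>c. ennreal (Mn M n c / S))) (prodsp n)"
    using C by (auto simp: measurable_def space_point_measure sets_point_measure)
  have int_Q: "(\<integral>\<^sup>+y. F y \<partial>Q) = (\<Sum>c\<in>C. ennreal (Mn M n c / S) * F c)"
    if "F \<in> borel_measurable (prodsp n)" for F
    unfolding Q_def using nn_integral_distr[OF id] that C(1)
    by (simp add: nn_integral_point_measure_finite)
  have "emeasure Q (space Q) = (\<Sum>c\<in>C. ennreal (Mn M n c / S))"
    using int_Q[of "\<lambda>_. 1"] by simp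
  also have "\<dots> = ennreal (\<Sum>c\<in>C. Mn M n c / S)"
    using S Mn_pos by (intro sum_ennreal) (auto intro: less_imp_le divide_pos_pos)
  also have "(\<Sum>c\<in>C. Mn M n c / S) = 1"
    using S by (simp add: S_def MnC_def flip: sum_divide_distrib)
  finally have Q: "prob_space Q" by (intro prob_spaceI) simp
  interpret Q: prob_space Q by (fact Q)
  interpret p: prob_space p unfolding p_def by (rule prob_space_Pn)
  \<comment> \<open>On the graph of \<open>\<phi>\<close> only one summand survives. Membership in
    singletons is a measurable test, so the finite sum gives joint measurability; it also vanishes
    when the output is no codeword.\<close>
  define h where "h w = (\<Sum>c\<in>C. if \<phi> (fst w) \<in> {c} \<and> snd w \<in> {c} then S / Mn M n c else 0)"
    for w
  have h_meas: "h \<in> borel_measurable (p \<Otimes>\<^sub>M prodsp n)" unfolding h_def by measurable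
  then have h_meas': "h \<in> borel_measurable (prodsp n \<Otimes>\<^sub>M prodsp n)" by measurable
  note h_meas [measurable]
  have h_at: "h (x, c) = (if \<phi> x = c then S / Mn M n c else 0)" if "c \<in> C" for x c
  proof -
    have "h (x, c) = (\<Sum>c'\<in>C. if c' = c then (if \<phi> x = c then S / Mn M n c else 0) else 0)"
      unfolding h_def by (intro sum.cong) auto
    also have "\<dots> = (if \<phi> x = c then S / Mn M n c else 0)"
      using C(1) that by (subst sum.delta) auto
    finally show ?thesis .
  qed
  have h0: "0 \<le> h w" for w
    unfolding h_def using S Mn_pos by (intro sum_nonneg) (auto intro: less_imp_le divide_pos_pos)
  define W where "W = density (p \<Otimes>\<^sub>M Q) (\<lambda>w. ennreal (h w))"
  have graph [measurable]: "(\<lambda>x. (x, \<phi> x)) \<in> measurable p (p \<Otimes>\<^sub>M Q)" by measurable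
  \<comment> \<open>For fixed x only the codeword \<open>\<phi> x\<close> contributes, and its
    \<open>Q\<close>-weight times the density there is 1.\<close>
  have W_eq: "W = distr p (p \<Otimes>\<^sub>M Q) (\<lambda>x. (x, \<phi> x))"
  proof (rule measure_eqI)
    fix A assume "A \<in> sets W"
    then have A [measurable]: "A \<in> sets (p \<Otimes>\<^sub>M Q)" by (simp add: W_def)
    have A': "A \<in> sets (p \<Otimes>\<^sub>M prodsp n)"
      using A by (subst (asm) sets_pair_measure_cong[OF refl sets_Q])
    have "emeasure W A = (\<integral>\<^sup>+w. ennreal (h w) * indicator A w \<partial>(p \<Otimes>\<^sub>M Q))"
      unfolding W_def by (rule emeasure_density) auto
    also have "\<dots> = (\<integral>\<^sup>+x. (\<integral>\<^sup>+y. ennreal (h (x, y)) * indicator A (x, y) \<partial>Q) \<partial>p)"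
      by (subst Q.nn_integral_fst[symmetric]) auto
    also have "\<dots> = (\<integral>\<^sup>+x. indicator A (x, \<phi> x) \<partial>p)"
    proof (rule nn_integral_cong)
      fix x assume x [simp]: "x \<in> space p"
      have "(\<integral>\<^sup>+y. ennreal (h (x, y)) * indicator A (x, y) \<partial>Q)
          = (\<Sum>c\<in>C. ennreal (Mn M n c / S) * (ennreal (h (x, c)) * indicator A (x, c)))"
        using measurable_compose[OF measurable_Pair1'[OF x] h_meas]
          measurable_compose[OF measurable_Pair1'[OF x] borel_measurable_indicator[OF A']]
        by (intro int_Q borel_measurable_times_ennreal measurable_compose[OF _ measurable_ennreal])
      also have "\<dots> = (\<Sum>c\<in>C. if \<phi> x = c then indicator A (x, c) else 0)"
        using S Mn_pos[of n]
        by (intro sum.cong refl)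
          (auto simp: h_at mult.assoc[symmetric] less_imp_le less_imp_neq[symmetric]
            simp flip: ennreal_mult)
      also have "\<dots> = indicator A (x, \<phi> x)" using C(1) \<phi>_C by (subst sum.delta') auto
      finally show "(\<integral>\<^sup>+y. ennreal (h (x, y)) * indicator A (x, y) \<partial>Q) = indicator A (x, \<phi> x)" .
    qed
    also have "\<dots> = (\<integral>\<^sup>+w. indicator A w \<partial>distr p (p \<Otimes>\<^sub>M Q) (\<lambda>x. (x, \<phi> x)))"
      by (subst nn_integral_distr) auto
    also have "\<dots> = emeasure (distr p (p \<Otimes>\<^sub>M Q) (\<lambda>x. (x, \<phi> x))) A" by simp
    finally show "emeasure W A = emeasure (distr p (p \<Otimes>\<^sub>M Q) (\<lambda>x. (x, \<phi> x))) A" .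
  qed (simp add: W_def)
  have [measurable]: "(\<lambda>y. ln (Mn M n y)) \<in> borel_measurable (prodsp n)" by measurable
  have fst_W: "distr W (prodsp n) fst = p"
    unfolding W_eq by (subst distr_distr) (auto simp: comp_def sets_p intro: distr_id2)
  have "(\<integral>\<^sup>+w. ennreal (rho_n rho n (fst w) (snd w)) \<partial>W) = (\<integral>\<^sup>+x. ennreal (rho_set rho n x C) \<partial>p)"
    unfolding W_eq by (subst nn_integral_distr) (auto simp: \<phi>_min)
  with dist have dist_W: "(\<integral>\<^sup>+w. ennreal (rho_n rho n (fst w) (snd w)) \<partial>W) \<le> ennreal D"
    by (simp add: p_def)
  have bound: "\<bar>ln (Mn M n (\<phi> x))\<bar> \<le> (\<Sum>c\<in>C. \<bar>ln (Mn M n c)\<bar>)" for x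
    by (rule member_le_sum[OF \<phi>_C _ C(1)]) simp
  have int_M: "integrable p (\<lambda>x. ln (Mn M n (\<phi> x)))"
    using bound by (intro p.integrable_const_bound[where B = "\<Sum>c\<in>C. \<bar>ln (Mn M n c)\<bar>"]) auto
  have ln_h: "ln (h (x, \<phi> x)) = ln S - ln (Mn M n (\<phi> x))" for x
    using S Mn_pos[of n "\<phi> x"] \<phi>_C[of x] by (simp add: h_at ln_div)
  have "integrable W (\<lambda>w. ln (Mn M n (snd w)))"
    unfolding W_eq using int_M by (subst integrable_distr_eq) auto
  moreover have "integrable W (\<lambda>w. ln (h w))"
    unfolding W_eq using int_M by (subst integrable_distr_eq) (auto simp: ln_h)
  ultimately have "test_channel n D Q h W"
    unfolding test_channel_def
    using Q sets_Q h_meas' h0 W_def[unfolded p_def] fst_W[unfolded p_def] dist_W by blast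
  then have "R_n P rho M n D \<le> ereal (cost n h W)" by (rule R_n_le_cost)
  also have "cost n h W = (\<integral>x. ln (h (x, \<phi> x)) \<partial>p) + (\<integral>x. ln (Mn M n (\<phi> x)) \<partial>p)"
    unfolding cost_def W_eq by (subst (1 2) integral_distr) auto
  also have "\<dots> = ln S" using int_M by (simp add: ln_h p.prob_space)
  finally show ?thesis by (simp add: S_def)
qed

section \<open>Subadditivity under stationarity\<close>

text \<open>The inner integral is a density of the source law against itself, because the first
  marginal of \<open>W\<close> is that law; uniqueness of densities gives 1. So
  \<open>h (x, y)\<close> acts as a conditional density of the output given x, and no disintegration
  theorem is invoked.\<close>

lemma test_channel_kernel:
  assumes tc: "test_channel n D Q h W"
  shows "AE x in Pn P n. (\<integral>\<^sup>+y. ennreal (h (x, y)) \<partial>Q) = 1"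
proof -
  note [measurable_cong] = test_channel_sets[OF tc]
  define p where "p = Pn P n"
  have sets_p [measurable_cong]: "sets p = sets (prodsp n)" by (simp add: p_def)
  interpret p: prob_space p unfolding p_def by (rule prob_space_Pn)
  from tc have Q: "prob_space Q" and sets_Q [measurable_cong]: "sets Q = sets (prodsp n)"
    and h [measurable]: "h \<in> borel_measurable (prodsp n \<Otimes>\<^sub>M prodsp n)"
    and W_eq: "W = density (p \<Otimes>\<^sub>M Q) (\<lambda>w. ennreal (h w))"
    and fst_W: "distr W (prodsp n) fst = p"
    by (auto simp: test_channel_def p_def)
  interpret Q: prob_space Q by (fact Q)
  have "density p (\<lambda>x. \<integral>\<^sup>+y. ennreal (h (x, y)) \<partial>Q) = p"
  proof (rule measure_eqI)
    fix A assume "A \<in> sets (density p (\<lambda>x. \<integral>\<^sup>+y. ennreal (h (x, y)) \<partial>Q))"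
    then have A: "A \<in> sets p" and [measurable]: "A \<in> sets (prodsp n)" by (simp_all add: sets_p)
    have "emeasure p A = emeasure (distr W (prodsp n) fst) A" by (simp only: fst_W)
    also have "\<dots> = (\<integral>\<^sup>+x. indicator A x \<partial>distr W (prodsp n) fst)" by simp
    also have "\<dots> = (\<integral>\<^sup>+w. indicator A (fst w) \<partial>W)"
      by (rule nn_integral_distr) auto
    also have "\<dots> = (\<integral>\<^sup>+w. ennreal (h w) * indicator A (fst w) \<partial>(p \<Otimes>\<^sub>M Q))"
      unfolding W_eq by (rule nn_integral_density) auto
    also have "\<dots> = (\<integral>\<^sup>+x. (\<integral>\<^sup>+y. ennreal (h (x, y)) * indicator A x \<partial>Q) \<partial>p)"
      by (subst Q.nn_integral_fst[symmetric]) auto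
    also have "\<dots> = (\<integral>\<^sup>+x. (\<integral>\<^sup>+y. ennreal (h (x, y)) \<partial>Q) * indicator A x \<partial>p)"
    proof (intro nn_integral_cong nn_integral_multc)
      fix x assume "x \<in> space p"
      then have "x \<in> space (prodsp n)" using sets_eq_imp_space_eq[OF sets_p] by simp
      then show "(\<lambda>y. ennreal (h (x, y))) \<in> borel_measurable Q" by measurable
    qed
    also have "\<dots> = emeasure (density p (\<lambda>x. \<integral>\<^sup>+y. ennreal (h (x, y)) \<partial>Q)) A"
      using A by (subst emeasure_density) auto
    finally show "emeasure (density p (\<lambda>x. \<integral>\<^sup>+y. ennreal (h (x, y)) \<partial>Q)) A = emeasure p A" ..
  qed simp
  then have "density p (\<lambda>x. \<integral>\<^sup>+y. ennreal (h (x, y)) \<partial>Q) = density p (\<lambda>_. 1)"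
    by (simp add: density_1)
  then have "AE x in p. (\<integral>\<^sup>+y. ennreal (h (x, y)) \<partial>Q) = 1"
    by (subst (asm) p.density_unique_iff) auto
  then show ?thesis unfolding p_def .
qed

section \<open>Cutting a word of length n + m into two blocks\<close>

lemma distr_Pn_prefix:
  "distr (Pn P (n + m)) (prodsp n) (\<lambda>x. restrict x {..<n}) = Pn P n"
  unfolding Pn_def by (subst distr_distr) (auto simp: comp_def Int_absorb1)

lemma distr_Pn_window:
  assumes "stationary P" "k + m \<le> n"
  shows "distr (Pn P n) (prodsp m) (\<lambda>x. \<lambda>i\<in>{..<m}. x (i + k)) = Pn P m"
proof -
  have "distr (Pn P n) (prodsp m) (\<lambda>x. \<lambda>i\<in>{..<m}. x (i + k))
      = distr P (prodsp m) (\<lambda>x. \<lambda>i\<in>{..<m}. x (i + k))"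
    unfolding Pn_def using assms(2)
    by (subst distr_distr) (auto simp: comp_def intro!: distr_cong restrict_ext)
  then show ?thesis using assms(1) by (simp add: stationary_def)
qed

text \<open>The weights form a convex combination, which is why two blocks at level D give a long
  block at the same level D.\<close>

lemma rho_n_split:
  assumes "0 < n + m"
  shows "rho_n rho (n + m) x y = real n / real (n + m) * rho_n rho n (restrict x {..<n}) (restrict y {..<n})
    + real m / real (n + m) * rho_n rho m (\<lambda>i\<in>{..<m}. x (i + n)) (\<lambda>i\<in>{..<m}. y (i + n))"
proof -
  have "(\<Sum>i<n + m. rho (x i) (y i)) = (\<Sum>i<n. rho (x i) (y i)) + (\<Sum>i<m. rho (x (i + n)) (y (i + n)))"
    by (induction m) (auto simp: add.commute)
  \<comment> \<open>An empty block has weight 0, which hides the division by zero in its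
    \<open>rho_n\<close>.\<close>
  then show ?thesis
    by (cases "n = 0"; cases "m = 0") (auto simp: rho_n_def add_divide_distrib)
qed

lemma Mn_split:
  "Mn M (n + m) y = Mn M n (restrict y {..<n}) * Mn M m (\<lambda>i\<in>{..<m}. y (i + n))"
  unfolding Mn_def by (induction m) (auto simp: add.commute)

text \<open>The channels act independently on the two blocks. Their outputs may still be dependent, so
  the product of Q1 and Q2 serves only as reference measure here.\<close>

lemma test_channel_concat:
  assumes stat: "stationary P" and nm: "0 < n + m"
    and tc1: "test_channel n D Q1 f W1" and tc2: "test_channel m D Q2 g W2"
  shows "\<exists>Q h W. test_channel (n + m) D Q h W \<and> cost (n + m) h W = cost n f W1 + cost m g W2"
proof -
  define N where "N = n + m"
  define a :: "(nat \<Rightarrow> 'a) \<Rightarrow> nat \<Rightarrow> 'a" where "a x = restrict x {..<n}" for x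
  define b :: "(nat \<Rightarrow> 'a) \<Rightarrow> nat \<Rightarrow> 'a" where "b x = (\<lambda>i\<in>{..<m}. x (i + n))" for x
  define a' :: "(nat \<Rightarrow> 'b) \<Rightarrow> nat \<Rightarrow> 'b" where "a' x = restrict x {..<n}" for x
  define b' :: "(nat \<Rightarrow> 'b) \<Rightarrow> nat \<Rightarrow> 'b" where "b' x = (\<lambda>i\<in>{..<m}. x (i + n))" for x
  define J :: "(nat \<Rightarrow> 'b) \<times> (nat \<Rightarrow> 'b) \<Rightarrow> nat \<Rightarrow> 'b"
    where "J w = (\<lambda>i\<in>{..<N}. if i < n then fst w i else snd w (i - n))" for w
  have a [measurable]: "a \<in> measurable (prodsp N) (prodsp n)"
    unfolding a_def N_def by (intro measurable_restrict_subset) auto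
  have a' [measurable]: "a' \<in> measurable (prodsp N) (prodsp n)"
    unfolding a'_def N_def by (intro measurable_restrict_subset) auto
  have b [measurable]: "b \<in> measurable (prodsp N) (prodsp m)"
    unfolding b_def N_def by (intro measurable_restrict measurable_component_singleton) auto
  have b' [measurable]: "b' \<in> measurable (prodsp N) (prodsp m)"
    unfolding b'_def N_def by (intro measurable_restrict measurable_component_singleton) auto
  have J [measurable]: "J \<in> measurable (prodsp n \<Otimes>\<^sub>M prodsp m) (prodsp N)"
    unfolding J_def
  proof (rule measurable_restrict)
    fix i assume i: "i \<in> {..<N}"
    show "(\<lambda>w. if i < n then fst w i else snd w (i - n))
        \<in> borel_measurable (prodsp n \<Otimes>\<^sub>M prodsp m :: ((nat \<Rightarrow> 'b) \<times> (nat \<Rightarrow> 'b)) measure)"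
    proof (cases "i < n")
      case True
      then have "(\<lambda>u. u i) \<in> borel_measurable (prodsp n :: (nat \<Rightarrow> 'b) measure)"
        by (intro measurable_component_singleton) auto
      with True show ?thesis by (auto intro: measurable_compose[OF measurable_fst])
    next
      case False
      with i have "(\<lambda>u. u (i - n)) \<in> borel_measurable (prodsp m :: (nat \<Rightarrow> 'b) measure)"
        by (intro measurable_component_singleton) (auto simp: N_def)
      with False show ?thesis by (auto intro: measurable_compose[OF measurable_snd])
    qed
  qed
  have a'J: "a' (J (u, v)) = u" if "u \<in> space (prodsp n)" for u v
    using that unfolding a'_def J_def N_def space_PiM
    by (intro extensionalityI[of _ "{..<n}"]) (auto simp: PiE_def)
  have b'J: "b' (J (u, v)) = v" if "v \<in> space (prodsp m)" for u v
    using that unfolding b'_def J_def N_def space_PiM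
    by (intro extensionalityI[of _ "{..<m}"]) (auto simp: PiE_def)

  note sets_W1 [measurable_cong] = test_channel_sets[OF tc1]
  note sets_W2 [measurable_cong] = test_channel_sets[OF tc2]
  from tc1 have Q1: "prob_space Q1" and sets_Q1 [measurable_cong]: "sets Q1 = sets (prodsp n)"
    and f [measurable]: "f \<in> borel_measurable (prodsp n \<Otimes>\<^sub>M prodsp n)" and f0: "\<And>w. 0 \<le> f w"
    and W1: "W1 = density (Pn P n \<Otimes>\<^sub>M Q1) (\<lambda>w. ennreal (f w))"
    and dist1: "(\<integral>\<^sup>+w. ennreal (rho_n rho n (fst w) (snd w)) \<partial>W1) \<le> ennreal D"
    and int1: "integrable W1 (\<lambda>w. ln (f w))" "integrable W1 (\<lambda>w. ln (Mn M n (snd w)))"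
    by (auto simp: test_channel_def)
  from tc2 have Q2: "prob_space Q2" and sets_Q2 [measurable_cong]: "sets Q2 = sets (prodsp m)"
    and g [measurable]: "g \<in> borel_measurable (prodsp m \<Otimes>\<^sub>M prodsp m)" and g0: "\<And>w. 0 \<le> g w"
    and W2: "W2 = density (Pn P m \<Otimes>\<^sub>M Q2) (\<lambda>w. ennreal (g w))"
    and dist2: "(\<integral>\<^sup>+w. ennreal (rho_n rho m (fst w) (snd w)) \<partial>W2) \<le> ennreal D"
    and int2: "integrable W2 (\<lambda>w. ln (g w))" "integrable W2 (\<lambda>w. ln (Mn M m (snd w)))"
    by (auto simp: test_channel_def)
  interpret Q1: prob_space Q1 by (fact Q1)
  interpret Q2: prob_space Q2 by (fact Q2)
  interpret Q12: pair_prob_space Q1 Q2 ..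
  define p where "p = Pn P N"
  have sets_p [measurable_cong]: "sets p = sets (prodsp N)" by (simp add: p_def)
  interpret p: prob_space p unfolding p_def by (rule prob_space_Pn)
  have distr_a: "distr p (prodsp n) a = Pn P n"
    unfolding p_def N_def a_def using distr_Pn_prefix by simp
  \<comment> \<open>Stationarity enters the construction only here: the second piece of the source
    word has the law for which \<open>g\<close> is normalised.\<close>
  have distr_b: "distr p (prodsp m) b = Pn P m"
    unfolding p_def N_def b_def by (rule distr_Pn_window[OF stat]) simp
  have a_p [measurable]: "a \<in> measurable p (prodsp n)" and b_p [measurable]: "b \<in> measurable p (prodsp m)"
    by measurable
  have "AE x in distr p (prodsp n) a. (\<integral>\<^sup>+u. ennreal (f (x, u)) \<partial>Q1) = 1"
    unfolding distr_a by (rule test_channel_kernel[OF tc1])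
  then have kernel_f: "AE x in p. (\<integral>\<^sup>+u. ennreal (f (a x, u)) \<partial>Q1) = 1"
    by (rule AE_distrD[OF a_p])
  have "AE x in distr p (prodsp m) b. (\<integral>\<^sup>+v. ennreal (g (x, v)) \<partial>Q2) = 1"
    unfolding distr_b by (rule test_channel_kernel[OF tc2])
  then have kernel_g: "AE x in p. (\<integral>\<^sup>+v. ennreal (g (b x, v)) \<partial>Q2) = 1"
    by (rule AE_distrD[OF b_p])

  define Q where "Q = distr (Q1 \<Otimes>\<^sub>M Q2) (prodsp N) J"
  have J12 [measurable]: "J \<in> measurable (Q1 \<Otimes>\<^sub>M Q2) (prodsp N)" by measurable
  have sets_Q [measurable_cong]: "sets Q = sets (prodsp N)" by (simp add: Q_def)
  have Q: "prob_space Q" unfolding Q_def by (rule Q12.prob_space_distr) measurable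
  interpret Q: prob_space Q by (fact Q)
  have int_Q: "(\<integral>\<^sup>+y. F y \<partial>Q) = (\<integral>\<^sup>+u. \<integral>\<^sup>+v. F (J (u, v)) \<partial>Q2 \<partial>Q1)"
    if [measurable]: "F \<in> borel_measurable (prodsp N)" for F
    unfolding Q_def by (subst nn_integral_distr, simp_all, subst Q2.nn_integral_fst[symmetric]) auto

  \<comment> \<open>Both factors read the same source word, each its own piece; the dependence
    between the pieces stays in \<open>p\<close>.\<close>
  define h where "h w = f (a (fst w), a' (snd w)) * g (b (fst w), b' (snd w))" for w
  have h [measurable]: "h \<in> borel_measurable (prodsp N \<Otimes>\<^sub>M prodsp N)" unfolding h_def by measurable
  have h0: "0 \<le> h w" for w using f0 g0 by (simp add: h_def)
  define W where "W = density (p \<Otimes>\<^sub>M Q) (\<lambda>w. ennreal (h w))"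
  have sets_W [measurable_cong]: "sets W = sets (prodsp N \<Otimes>\<^sub>M prodsp N)"
    unfolding W_def using sets_pair_measure_cong[OF sets_p sets_Q] by simp
  \<comment> \<open>The marginals of \<open>W\<close> are all read off from this iterated integral:
    the choice of \<open>G\<close> decides which of the two kernels integrates out to 1.\<close>
  have int_W: "(\<integral>\<^sup>+w. G w \<partial>W) = (\<integral>\<^sup>+x. \<integral>\<^sup>+u. \<integral>\<^sup>+v.
      ennreal (f (a x, u)) * ennreal (g (b x, v)) * G (x, J (u, v)) \<partial>Q2 \<partial>Q1 \<partial>p)"
    if G [measurable]: "G \<in> borel_measurable (prodsp N \<Otimes>\<^sub>M prodsp N)" for G
  proof -
    have "(\<integral>\<^sup>+w. G w \<partial>W) = (\<integral>\<^sup>+w. ennreal (h w) * G w \<partial>(p \<Otimes>\<^sub>M Q))"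
      unfolding W_def by (rule nn_integral_density) measurable
    also have "\<dots> = (\<integral>\<^sup>+x. (\<integral>\<^sup>+y. ennreal (h (x, y)) * G (x, y) \<partial>Q) \<partial>p)"
      by (subst Q.nn_integral_fst[symmetric]) measurable
    also have "\<dots> = (\<integral>\<^sup>+x. \<integral>\<^sup>+u. \<integral>\<^sup>+v.
      ennreal (f (a x, u)) * ennreal (g (b x, v)) * G (x, J (u, v)) \<partial>Q2 \<partial>Q1 \<partial>p)"
    proof (rule nn_integral_cong)
      fix x assume "x \<in> space p"
      then have x: "x \<in> space (prodsp N)" using sets_eq_imp_space_eq[OF sets_p] by simp
      have "(\<lambda>y. ennreal (h (x, y)) * G (x, y)) \<in> borel_measurable (prodsp N)"
        using measurable_compose[OF measurable_Pair1'[OF x] h]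
          measurable_compose[OF measurable_Pair1'[OF x] G]
        by (intro borel_measurable_times_ennreal measurable_compose[OF _ measurable_ennreal])
      then have "(\<integral>\<^sup>+y. ennreal (h (x, y)) * G (x, y) \<partial>Q)
          = (\<integral>\<^sup>+u. \<integral>\<^sup>+v. ennreal (h (x, J (u, v))) * G (x, J (u, v)) \<partial>Q2 \<partial>Q1)"
        by (rule int_Q)
      also have "\<dots> = (\<integral>\<^sup>+u. \<integral>\<^sup>+v.
          ennreal (f (a x, u)) * ennreal (g (b x, v)) * G (x, J (u, v)) \<partial>Q2 \<partial>Q1)"
        using sets_eq_imp_space_eq[OF sets_Q1] sets_eq_imp_space_eq[OF sets_Q2]
        by (intro nn_integral_cong) (simp add: h_def a'J b'J ennreal_mult f0 g0)
      finally show "(\<integral>\<^sup>+y. ennreal (h (x, y)) * G (x, y) \<partial>Q) = (\<integral>\<^sup>+u. \<integral>\<^sup>+v.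
          ennreal (f (a x, u)) * ennreal (g (b x, v)) * G (x, J (u, v)) \<partial>Q2 \<partial>Q1)" .
    qed
    finally show ?thesis .
  qed
  have f_meas: "(\<lambda>u. ennreal (f (a x, u))) \<in> borel_measurable Q1"
    and g_meas: "(\<lambda>v. ennreal (g (b x, v))) \<in> borel_measurable Q2" if "x \<in> space p" for x
    using that measurable_space[OF a_p] measurable_space[OF b_p] by measurable

  have fst_W: "distr W (prodsp N) fst = p"
  proof (rule measure_eqI)
    fix A assume "A \<in> sets (distr W (prodsp N) fst)"
    then have A [measurable]: "A \<in> sets (prodsp N)" by simp
    have "emeasure (distr W (prodsp N) fst) A = (\<integral>\<^sup>+x. indicator A x \<partial>distr W (prodsp N) fst)"
      by simp
    also have "\<dots> = (\<integral>\<^sup>+w. indicator A (fst w) \<partial>W)" by (rule nn_integral_distr) measurable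
    also have "\<dots> = (\<integral>\<^sup>+x. \<integral>\<^sup>+u. \<integral>\<^sup>+v.
      ennreal (f (a x, u)) * ennreal (g (b x, v)) * indicator A x \<partial>Q2 \<partial>Q1 \<partial>p)"
      by (subst int_W) simp_all
    also have "\<dots> = (\<integral>\<^sup>+x. indicator A x \<partial>p)"
    proof (rule nn_integral_cong_AE)
      show "AE x in p. (\<integral>\<^sup>+u. \<integral>\<^sup>+v. ennreal (f (a x, u)) * ennreal (g (b x, v)) * indicator A x \<partial>Q2 \<partial>Q1)
          = indicator A x"
        using kernel_f kernel_g AE_space
        by eventually_elim (simp add: nn_integral_cmult nn_integral_multc f_meas g_meas)
    qed
    also have "\<dots> = emeasure p A" by (simp add: sets_p)
    finally show "emeasure (distr W (prodsp N) fst) A = emeasure p A" .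
  qed (simp add: sets_p)

  have pair_a [measurable]: "(\<lambda>w. (a (fst w), a' (snd w))) \<in> measurable W (prodsp n \<Otimes>\<^sub>M prodsp n)"
    and pair_b [measurable]: "(\<lambda>w. (b (fst w), b' (snd w))) \<in> measurable W (prodsp m \<Otimes>\<^sub>M prodsp m)"
    by measurable
  \<comment> \<open>Identifying the block marginals of \<open>W\<close> with \<open>W1\<close> and
    \<open>W2\<close> lets distortion, log density and log mass carry over by change of
    variables.\<close>
  have distr_W1: "distr W (prodsp n \<Otimes>\<^sub>M prodsp n) (\<lambda>w. (a (fst w), a' (snd w))) = W1" (is "?L = _")
  proof (rule measure_eqI)
    fix A assume "A \<in> sets ?L"
    then have A [measurable]: "A \<in> sets (prodsp n \<Otimes>\<^sub>M prodsp n)" by simp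
    have "emeasure ?L A = (\<integral>\<^sup>+w. indicator A w \<partial>?L)" by simp
    also have "\<dots> = (\<integral>\<^sup>+w. indicator A (a (fst w), a' (snd w)) \<partial>W)"
      by (rule nn_integral_distr) measurable
    also have "\<dots> = (\<integral>\<^sup>+x. \<integral>\<^sup>+u. \<integral>\<^sup>+v.
      ennreal (f (a x, u)) * ennreal (g (b x, v)) * indicator A (a x, a' (J (u, v))) \<partial>Q2 \<partial>Q1 \<partial>p)"
      by (subst int_W) simp_all
    also have "\<dots> = (\<integral>\<^sup>+x. \<integral>\<^sup>+u. \<integral>\<^sup>+v.
      ennreal (f (a x, u)) * ennreal (g (b x, v)) * indicator A (a x, u) \<partial>Q2 \<partial>Q1 \<partial>p)"
      using sets_eq_imp_space_eq[OF sets_Q1] by (intro nn_integral_cong) (simp add: a'J)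
    also have "\<dots> = (\<integral>\<^sup>+x. \<integral>\<^sup>+u. ennreal (f (a x, u)) * indicator A (a x, u) \<partial>Q1 \<partial>p)"
    proof (rule nn_integral_cong_AE)
      show "AE x in p. (\<integral>\<^sup>+u. \<integral>\<^sup>+v. ennreal (f (a x, u)) * ennreal (g (b x, v)) * indicator A (a x, u) \<partial>Q2 \<partial>Q1)
          = (\<integral>\<^sup>+u. ennreal (f (a x, u)) * indicator A (a x, u) \<partial>Q1)"
        using kernel_g AE_space
        by eventually_elim (simp add: nn_integral_cmult nn_integral_multc g_meas)
    qed
    also have "\<dots> = (\<integral>\<^sup>+x. \<integral>\<^sup>+u. ennreal (f (x, u)) * indicator A (x, u) \<partial>Q1 \<partial>Pn P n)"
      unfolding distr_a[symmetric] by (rule nn_integral_distr[symmetric]) measurable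
    also have "\<dots> = (\<integral>\<^sup>+w. ennreal (f w) * indicator A w \<partial>(Pn P n \<Otimes>\<^sub>M Q1))"
      by (subst Q1.nn_integral_fst[symmetric]) measurable
    also have "\<dots> = (\<integral>\<^sup>+w. indicator A w \<partial>W1)"
      unfolding W1 by (rule nn_integral_density[symmetric]) measurable
    also have "\<dots> = emeasure W1 A" by (simp add: sets_W1)
    finally show "emeasure ?L A = emeasure W1 A" .
  qed (simp add: sets_W1)
  have distr_W2: "distr W (prodsp m \<Otimes>\<^sub>M prodsp m) (\<lambda>w. (b (fst w), b' (snd w))) = W2" (is "?L = _")
  proof (rule measure_eqI)
    fix A assume "A \<in> sets ?L"
    then have A [measurable]: "A \<in> sets (prodsp m \<Otimes>\<^sub>M prodsp m)" by simp
    have ind_v: "(\<lambda>v. indicator A (b x, v) :: ennreal) \<in> borel_measurable Q2" if "x \<in> space p" for x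
      using that measurable_space[OF b_p] by measurable
    have "emeasure ?L A = (\<integral>\<^sup>+w. indicator A w \<partial>?L)" by simp
    also have "\<dots> = (\<integral>\<^sup>+w. indicator A (b (fst w), b' (snd w)) \<partial>W)"
      by (rule nn_integral_distr) measurable
    also have "\<dots> = (\<integral>\<^sup>+x. \<integral>\<^sup>+u. \<integral>\<^sup>+v.
      ennreal (f (a x, u)) * ennreal (g (b x, v)) * indicator A (b x, b' (J (u, v))) \<partial>Q2 \<partial>Q1 \<partial>p)"
      by (subst int_W) simp_all
    also have "\<dots> = (\<integral>\<^sup>+x. \<integral>\<^sup>+u. \<integral>\<^sup>+v.
      ennreal (f (a x, u)) * (ennreal (g (b x, v)) * indicator A (b x, v)) \<partial>Q2 \<partial>Q1 \<partial>p)"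
      using sets_eq_imp_space_eq[OF sets_Q2] by (intro nn_integral_cong) (simp add: b'J mult.assoc)
    also have "\<dots> = (\<integral>\<^sup>+x. \<integral>\<^sup>+v. ennreal (g (b x, v)) * indicator A (b x, v) \<partial>Q2 \<partial>p)"
    proof (rule nn_integral_cong_AE)
      show "AE x in p. (\<integral>\<^sup>+u. \<integral>\<^sup>+v. ennreal (f (a x, u)) * (ennreal (g (b x, v)) * indicator A (b x, v)) \<partial>Q2 \<partial>Q1)
          = (\<integral>\<^sup>+v. ennreal (g (b x, v)) * indicator A (b x, v) \<partial>Q2)"
        using kernel_f AE_space
        by eventually_elim (simp add: nn_integral_cmult nn_integral_multc f_meas g_meas ind_v)
    qed
    also have "\<dots> = (\<integral>\<^sup>+x. \<integral>\<^sup>+v. ennreal (g (x, v)) * indicator A (x, v) \<partial>Q2 \<partial>Pn P m)"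
      unfolding distr_b[symmetric] by (rule nn_integral_distr[symmetric]) measurable
    also have "\<dots> = (\<integral>\<^sup>+w. ennreal (g w) * indicator A w \<partial>(Pn P m \<Otimes>\<^sub>M Q2))"
      by (subst Q2.nn_integral_fst[symmetric]) measurable
    also have "\<dots> = (\<integral>\<^sup>+w. indicator A w \<partial>W2)"
      unfolding W2 by (rule nn_integral_density[symmetric]) measurable
    also have "\<dots> = emeasure W2 A" by (simp add: sets_W2)
    finally show "emeasure ?L A = emeasure W2 A" .
  qed (simp add: sets_W2)

  have rho_split: "rho_n rho N x y = real n / real N * rho_n rho n (a x) (a' y)
      + real m / real N * rho_n rho m (b x) (b' y)" for x y
    using rho_n_split[OF nm] by (simp add: N_def a_def a'_def b_def b'_def)
  have Mn_split': "Mn M N y = Mn M n (a' y) * Mn M m (b' y)" for y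
    using Mn_split by (simp add: N_def a'_def b'_def)

  have rho_a: "(\<integral>\<^sup>+w. ennreal (rho_n rho n (a (fst w)) (a' (snd w))) \<partial>W)
      = (\<integral>\<^sup>+w. ennreal (rho_n rho n (fst w) (snd w)) \<partial>W1)"
    unfolding distr_W1[symmetric] by (subst nn_integral_distr) simp_all
  have rho_b: "(\<integral>\<^sup>+w. ennreal (rho_n rho m (b (fst w)) (b' (snd w))) \<partial>W)
      = (\<integral>\<^sup>+w. ennreal (rho_n rho m (fst w) (snd w)) \<partial>W2)"
    unfolding distr_W2[symmetric] by (subst nn_integral_distr) simp_all
  have "(\<integral>\<^sup>+w. ennreal (rho_n rho N (fst w) (snd w)) \<partial>W)
      = (\<integral>\<^sup>+w. ennreal (real n / real N) * ennreal (rho_n rho n (a (fst w)) (a' (snd w)))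
        + ennreal (real m / real N) * ennreal (rho_n rho m (b (fst w)) (b' (snd w))) \<partial>W)"
    by (intro nn_integral_cong) (simp add: rho_split rho_n_nonneg flip: ennreal_mult ennreal_plus)
  also have "\<dots> = ennreal (real n / real N) * (\<integral>\<^sup>+w. ennreal (rho_n rho n (a (fst w)) (a' (snd w))) \<partial>W)
        + ennreal (real m / real N) * (\<integral>\<^sup>+w. ennreal (rho_n rho m (b (fst w)) (b' (snd w))) \<partial>W)"
  proof -
    have [measurable]: "(\<lambda>w. ennreal (rho_n rho n (a (fst w)) (a' (snd w)))) \<in> borel_measurable W"
      "(\<lambda>w. ennreal (rho_n rho m (b (fst w)) (b' (snd w)))) \<in> borel_measurable W"
      by measurable
    show ?thesis by (simp add: nn_integral_add nn_integral_cmult)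
  qed
  also have "\<dots> \<le> ennreal (real n / real N) * ennreal D + ennreal (real m / real N) * ennreal D"
    unfolding rho_a rho_b using dist1 dist2 by (intro add_mono mult_left_mono) auto
  also have "\<dots> = ennreal (real n / real N + real m / real N) * ennreal D"
    by (simp add: distrib_right)
  also have "real n / real N + real m / real N = 1"
    using nm by (simp add: N_def flip: add_divide_distrib of_nat_add)
  finally have dist: "(\<integral>\<^sup>+w. ennreal (rho_n rho N (fst w) (snd w)) \<partial>W) \<le> ennreal D" by simp

  have fm: "(\<lambda>w. ln (f w)) \<in> borel_measurable (prodsp n \<Otimes>\<^sub>M prodsp n)"
    and gm: "(\<lambda>w. ln (g w)) \<in> borel_measurable (prodsp m \<Otimes>\<^sub>M prodsp m)"
    and M1m: "(\<lambda>w. ln (Mn M n (snd w))) \<in> borel_measurable (prodsp n \<Otimes>\<^sub>M prodsp n :: ((nat \<Rightarrow> 'a) \<times> _) measure)"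
    and M2m: "(\<lambda>w. ln (Mn M m (snd w))) \<in> borel_measurable (prodsp m \<Otimes>\<^sub>M prodsp m :: ((nat \<Rightarrow> 'a) \<times> _) measure)"
    by measurable
  have if': "integrable W (\<lambda>w. ln (f (a (fst w), a' (snd w))))"
    "(\<integral>w. ln (f (a (fst w), a' (snd w))) \<partial>W) = (\<integral>w. ln (f w) \<partial>W1)"
    using int1(1) integrable_distr_eq[OF pair_a fm] integral_distr[OF pair_a fm] by (simp_all add: distr_W1)
  have ig': "integrable W (\<lambda>w. ln (g (b (fst w), b' (snd w))))"
    "(\<integral>w. ln (g (b (fst w), b' (snd w))) \<partial>W) = (\<integral>w. ln (g w) \<partial>W2)"
    using int2(1) integrable_distr_eq[OF pair_b gm] integral_distr[OF pair_b gm] by (simp_all add: distr_W2)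
  have im1: "integrable W (\<lambda>w. ln (Mn M n (a' (snd w))))"
    "(\<integral>w. ln (Mn M n (a' (snd w))) \<partial>W) = (\<integral>w. ln (Mn M n (snd w)) \<partial>W1)"
    using int1(2) integrable_distr_eq[OF pair_a M1m] integral_distr[OF pair_a M1m] by (simp_all add: distr_W1)
  have im2: "integrable W (\<lambda>w. ln (Mn M m (b' (snd w))))"
    "(\<integral>w. ln (Mn M m (b' (snd w))) \<partial>W) = (\<integral>w. ln (Mn M m (snd w)) \<partial>W2)"
    using int2(2) integrable_distr_eq[OF pair_b M2m] integral_distr[OF pair_b M2m] by (simp_all add: distr_W2)
  have "AE w in W. 0 < h w"
    unfolding W_def by (subst AE_density) (auto simp: ennreal_less_zero_iff)
  \<comment> \<open>Only almost everywhere: the logarithm of the product need not split where a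
    factor vanishes, but \<open>W\<close> has no mass there.\<close>
  then have ln_h: "AE w in W. ln (f (a (fst w), a' (snd w))) + ln (g (b (fst w), b' (snd w))) = ln (h w)"
  proof eventually_elim
    case (elim w)
    then have "f (a (fst w), a' (snd w)) \<noteq> 0" "g (b (fst w), b' (snd w)) \<noteq> 0" by (auto simp: h_def)
    then show ?case
      using f0[of "(a (fst w), a' (snd w))"] g0[of "(b (fst w), b' (snd w))"]
      by (simp add: h_def ln_mult)
  qed
  have lhm: "(\<lambda>w. ln (h w)) \<in> borel_measurable W"
    "(\<lambda>w. ln (f (a (fst w), a' (snd w))) + ln (g (b (fst w), b' (snd w)))) \<in> borel_measurable W"
    using if' ig' by (auto simp: borel_measurable_integrable)
  have int_h: "integrable W (\<lambda>w. ln (h w))"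
    using integrable_cong_AE[OF lhm(2,1) ln_h] if'(1) ig'(1) by simp
  have "(\<integral>w. ln (h w) \<partial>W) = (\<integral>w. ln (f (a (fst w), a' (snd w))) + ln (g (b (fst w), b' (snd w))) \<partial>W)"
    using integral_cong_AE[OF lhm(2,1) ln_h] by simp
  also have "\<dots> = (\<integral>w. ln (f w) \<partial>W1) + (\<integral>w. ln (g w) \<partial>W2)"
    using if' ig' by (simp add: Bochner_Integration.integral_add)
  finally have val_h: "(\<integral>w. ln (h w) \<partial>W) = (\<integral>w. ln (f w) \<partial>W1) + (\<integral>w. ln (g w) \<partial>W2)" .
  have ln_Mn: "ln (Mn M N y) = ln (Mn M n (a' y)) + ln (Mn M m (b' y))" for y
    using Mn_pos[of n "a' y"] Mn_pos[of m "b' y"] by (simp add: Mn_split' ln_mult)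
  have int_M: "integrable W (\<lambda>w. ln (Mn M N (snd w)))"
    and val_M: "(\<integral>w. ln (Mn M N (snd w)) \<partial>W)
      = (\<integral>w. ln (Mn M n (snd w)) \<partial>W1) + (\<integral>w. ln (Mn M m (snd w)) \<partial>W2)"
    using im1 im2 by (simp_all add: ln_Mn Bochner_Integration.integral_add)
  have "test_channel N D Q h W"
    unfolding test_channel_def
    using Q sets_Q h h0 W_def[unfolded p_def] fst_W[unfolded p_def] dist int_h int_M by blast
  moreover have "cost N h W = cost n f W1 + cost m g W2"
    by (simp add: cost_def val_h val_M)
  ultimately show ?thesis unfolding N_def by blast
qed

lemma R_n_subadditive:
  assumes "stationary P" "0 < n + m"
    and "R_n P rho M n D = ereal r" "R_n P rho M m D = ereal s"
  shows "R_n P rho M (n + m) D \<le> ereal (r + s)"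
proof (rule ereal_le_epsilon2)
  fix e :: real assume e: "0 < e"
  have "R_n P rho M n D < ereal (r + e / 2)" "R_n P rho M m D < ereal (s + e / 2)"
    using assms e by auto
  then obtain Q1 f W1 Q2 g W2
    where 1: "test_channel n D Q1 f W1" "cost n f W1 < r + e / 2"
      and 2: "test_channel m D Q2 g W2" "cost m g W2 < s + e / 2"
    by (metis R_n_lessE)
  then obtain Q h W where tc: "test_channel (n + m) D Q h W"
    and c: "cost (n + m) h W = cost n f W1 + cost m g W2"
    using test_channel_concat[OF assms(1,2)] by blast
  have "R_n P rho M (n + m) D \<le> ereal (cost (n + m) h W)" by (rule R_n_le_cost[OF tc])
  also have "\<dots> \<le> ereal (r + s + e)" using 1 2 c by simp
  finally show "R_n P rho M (n + m) D \<le> ereal (r + s) + ereal e" by simp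
qed

text \<open>The i-th letters of the codewords form a code of block length 1. Choosing a nearest
  letter at each position is at least as good as using the letters of one nearest codeword, so the n
  one-letter distortions average at most D. By stationarity each is a distortion under the law of a
  single letter, and the one-block bound applies to the best position.\<close>

lemma R_1_finite:
  assumes stat: "stationary P" and n: "1 \<le> n"
    and C: "finite C" "C \<noteq> {}" "C \<subseteq> space (prodsp n)"
    and dist: "(\<integral>\<^sup>+x. ennreal (rho_set rho n x C) \<partial>Pn P n) \<le> ennreal D"
  shows "R_n P rho M 1 D < \<infinity>"
proof -
  define s where "s i = (\<lambda>x::nat \<Rightarrow> 'a. \<lambda>j\<in>{..<1::nat}. x (j + i))" for i
  define C1 where "C1 i = (\<lambda>y. \<lambda>j\<in>{..<1::nat}. y (j + i)) ` C" for i
  have C1: "finite (C1 i)" "C1 i \<noteq> {}" "C1 i \<subseteq> space (prodsp 1)" for i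
    using C by (auto simp: C1_def space_PiM)
  have s: "s i \<in> measurable (Pn P n) (prodsp 1)" if "i < n" for i
    unfolding s_def using that
    by (intro measurable_restrict) (auto intro!: measurable_component_singleton simp: measurable_cong_sets[OF sets_Pn refl])
  have meas1: "(\<lambda>x. rho_set rho 1 x (C1 i)) \<in> borel_measurable (prodsp 1)" for i
    unfolding rho_set_def
    by (rule borel_measurable_Min[OF C1(1)])
      (use C1(3)[of i] in \<open>auto intro!: rho_n_measurable\<close>)
  have le: "(\<Sum>i<n. rho_set rho 1 (s i x) (C1 i)) \<le> real n * rho_set rho n x C" for x
  proof -
    have "rho_set rho n x C \<in> rho_n rho n x ` C"
      unfolding rho_set_def using C by (intro Min_in) auto
    then obtain y where y: "y \<in> C" "rho_set rho n x C = rho_n rho n x y" by auto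
    have "rho_set rho 1 (s i x) (C1 i) \<le> rho (x i) (y i)" for i
    proof -
      have "rho_set rho 1 (s i x) (C1 i) \<le> rho_n rho 1 (s i x) (\<lambda>j\<in>{..<1::nat}. y (j + i))"
        unfolding rho_set_def using C1(1)[of i] y(1) by (intro Min_le) (auto simp: C1_def)
      then show ?thesis by (simp add: rho_n_def s_def)
    qed
    then have "(\<Sum>i<n. rho_set rho 1 (s i x) (C1 i)) \<le> (\<Sum>i<n. rho (x i) (y i))"
      by (intro sum_mono)
    then show ?thesis using n y(2) by (simp add: rho_n_def)
  qed
  have nonneg: "0 \<le> rho_set rho k x B" if "finite B" "B \<noteq> {}" for k x B
    unfolding rho_set_def using that by (auto simp: rho_n_nonneg)
  define t where "t i = (\<integral>\<^sup>+x. ennreal (rho_set rho 1 x (C1 i)) \<partial>Pn P 1)" for i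
  have t: "t i = (\<integral>\<^sup>+x. ennreal (rho_set rho 1 (s i x) (C1 i)) \<partial>Pn P n)" if "i < n" for i
  proof -
    have "t i = (\<integral>\<^sup>+x. ennreal (rho_set rho 1 x (C1 i)) \<partial>distr (Pn P n) (prodsp 1) (s i))"
      using distr_Pn_window[OF stat, of i 1 n] that by (simp add: t_def s_def)
    also have "\<dots> = (\<integral>\<^sup>+x. ennreal (rho_set rho 1 (s i x) (C1 i)) \<partial>Pn P n)"
      by (rule nn_integral_distr[OF s[OF that]])
        (use meas1 in \<open>auto intro!: measurable_compose[OF _ measurable_ennreal]\<close>)
    finally show ?thesis .
  qed
  have "(\<Sum>i<n. t i) = (\<Sum>i<n. \<integral>\<^sup>+x. ennreal (rho_set rho 1 (s i x) (C1 i)) \<partial>Pn P n)"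
    by (intro sum.cong) (auto simp: t)
  also have "\<dots> = (\<integral>\<^sup>+x. (\<Sum>i<n. ennreal (rho_set rho 1 (s i x) (C1 i))) \<partial>Pn P n)"
    by (intro nn_integral_sum[symmetric] measurable_compose[OF _ measurable_ennreal]
        measurable_compose[OF s meas1]) simp
  also have "\<dots> \<le> (\<integral>\<^sup>+x. ennreal (real n) * ennreal (rho_set rho n x C) \<partial>Pn P n)"
    using le nonneg C C1
    by (intro nn_integral_mono) (simp add: sum_ennreal flip: ennreal_mult)
  also have "\<dots> = ennreal (real n) * (\<integral>\<^sup>+x. ennreal (rho_set rho n x C) \<partial>Pn P n)"
    unfolding rho_set_def using C
    by (intro nn_integral_cmult measurable_compose[OF _ measurable_ennreal] borel_measurable_Min
        rho_n_measurable) auto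
  also have "\<dots> \<le> ennreal (real n) * ennreal D"
    using dist by (rule mult_left_mono) simp
  finally have sum_t: "(\<Sum>i<n. t i) \<le> ennreal (real n) * ennreal D" .
  have "\<exists>i<n. t i \<le> ennreal D"
  proof -
    have ne: "{..<n} \<noteq> {}" using n by (auto simp: lessThan_empty_iff)
    define i where "i = arg_min_on t {..<n}"
    have i: "i < n" and min: "\<And>j. j < n \<Longrightarrow> t i \<le> t j"
      using arg_min_if_finite(1)[OF _ ne, of t] arg_min_least[OF _ ne, of _ t]
      by (auto simp: i_def)
    have "ennreal (real n) * t i \<le> (\<Sum>i<n. t i)"
      using sum_bounded_below[of "{..<n}" "t i" t] min by (simp add: ennreal_of_nat_eq_real_of_nat)
    also note sum_t
    finally have "t i \<le> ennreal D"
      using n by (subst (asm) ennreal_mult_le_mult_iff) auto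
    with i show ?thesis by blast
  qed
  then obtain i where "t i \<le> ennreal D" by blast
  then have "R_n P rho M 1 D \<le> ereal (ln (MnC M 1 (C1 i)))"
    unfolding t_def by (intro R_n_le_ln_MnC C1)
  also have "\<dots> < \<infinity>" by simp
  finally show ?thesis .
qed

section \<open>From subadditivity to the existence of the rate\<close>

lemma R_n_rate:
  assumes stat: "stationary P" and fin: "R_n P rho M 1 D < \<infinity>"
  shows "\<exists>L. (\<lambda>m. R_n P rho M m D / ereal (real m)) \<longlonglongrightarrow> ereal L
    \<and> (\<forall>n\<ge>1. ereal (real n * L) \<le> R_n P rho M n D)"
proof -
  define a where "a n = real_of_ereal (R_n P rho M n D)" for n
  \<comment> \<open>Finiteness spreads from length 1 by appending one letter at a time, while
    \<open>R_n_ge\<close> excludes minus infinity.\<close>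
  have R_a: "R_n P rho M n D = ereal (a n)" if "1 \<le> n" for n
    using that
  proof (induction n rule: nat_induct_at_least)
    case base
    show ?case using fin R_n_ge[of 1 D] by (cases "R_n P rho M 1 D") (auto simp: a_def)
  next
    case (Suc n)
    have "R_n P rho M 1 D = ereal (a 1)"
      using fin R_n_ge[of 1 D] by (cases "R_n P rho M 1 D") (auto simp: a_def)
    with Suc have "R_n P rho M (n + 1) D \<le> ereal (a n + a 1)"
      by (intro R_n_subadditive[OF stat]) auto
    then show ?case
      using R_n_ge[of "Suc n" D] by (cases "R_n P rho M (Suc n) D") (auto simp: a_def)
  qed
  have "a (m + n) \<le> a m + a n" if "1 \<le> m" "1 \<le> n" for m n
    using R_n_subadditive[OF stat _ R_a[OF that(1)] R_a[OF that(2)]] R_a[of "m + n"] that by simp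
  moreover have "real n * ln Mstar \<le> a n" if "1 \<le> n" for n
    using R_n_ge[of n D] R_a[OF that] by simp
  ultimately obtain L where L: "(\<lambda>n. a n / real n) \<longlonglongrightarrow> L" "\<And>n. 1 \<le> n \<Longrightarrow> real n * L \<le> a n"
    using fekete[of a] by blast
  have "(\<lambda>n. ereal (a n / real n)) \<longlonglongrightarrow> ereal L" using L(1) by simp
  \<comment> \<open>\<open>R_a\<close> speaks only of positive lengths, so the real and the extended
    quotients are compared from 1 on.\<close>
  moreover have "eventually (\<lambda>n. ereal (a n / real n) = R_n P rho M n D / ereal (real n)) sequentially"
    using eventually_ge_at_top[of 1] by eventually_elim (simp add: R_a)
  ultimately have "(\<lambda>n. R_n P rho M n D / ereal (real n)) \<longlonglongrightarrow> ereal L"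
    by (rule Lim_transform_eventually)
  then show ?thesis using L(2) R_a by auto
qed

end

text \<open>The existence of the limit defining R(D) is part of the conclusion; limits in
  \<open>ereal\<close> are unique, so \<open>L\<close> is R(D).\<close>

theorem theorem3:
  fixes P :: "(nat \<Rightarrow> 'a::polish_space) measure"
    and rho :: "'a \<Rightarrow> 'b::polish_space \<Rightarrow> real"
    and M :: "'b \<Rightarrow> real"
    and n :: nat and C :: "(nat \<Rightarrow> 'b) set" and D :: real
  assumes P_prob: "prob_space P"
    and P_sets: "sets P = sets (PiM (UNIV :: nat set) (\<lambda>_. (borel :: 'a measure)))"
    and rho_meas: "(\<lambda>(x, y). rho x y) \<in> borel_measurable (borel \<Otimes>\<^sub>M borel)"
    and rho_nonneg: "\<forall>x y. 0 \<le> rho x y"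
    and M_meas: "M \<in> borel_measurable borel"
    and M_lower: "\<exists>Mstar > 0. \<forall>y. Mstar \<le> M y"
    and n_pos: "1 \<le> n"
    and C_fin: "finite C" and C_ne: "C \<noteq> {}"
    and C_sub: "C \<subseteq> space (prodsp n :: (nat \<Rightarrow> 'b) measure)"
    and D_def: "(\<integral>\<^sup>+ x. ennreal (rho_set rho n x C) \<partial>(Pn P n)) = ennreal D"
  shows "ereal (ln (MnC M n C)) \<ge> R_n P rho M n D
         \<and> (stationary P \<longrightarrow>
              (\<exists>L. ((\<lambda>m. R_n P rho M m D / ereal (real m)) \<longlonglongrightarrow> L)
                   \<and> ereal (ln (MnC M n C)) \<ge> ereal (real n) * L))"
proof -
  obtain Mstar where Mstar: "0 < Mstar" "\<And>y. Mstar \<le> M y" using M_lower by blast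
  interpret rate_distortion P rho M Mstar
    using P_prob P_sets rho_meas rho_nonneg M_meas Mstar by (intro rate_distortion.intro) blast+
  have dist: "(\<integral>\<^sup>+x. ennreal (rho_set rho n x C) \<partial>Pn P n) \<le> ennreal D" using D_def by simp
  have R: "R_n P rho M n D \<le> ereal (ln (MnC M n C))"
    using C_fin C_ne C_sub dist by (rule R_n_le_ln_MnC)
  moreover have "\<exists>L. ((\<lambda>m. R_n P rho M m D / ereal (real m)) \<longlonglongrightarrow> L)
      \<and> ereal (ln (MnC M n C)) \<ge> ereal (real n) * L" if stat: "stationary P"
  proof -
    obtain L where lim: "(\<lambda>m. R_n P rho M m D / ereal (real m)) \<longlonglongrightarrow> ereal L"
      and "\<forall>k\<ge>1. ereal (real k * L) \<le> R_n P rho M k D"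
      using R_n_rate[OF stat R_1_finite[OF stat n_pos C_fin C_ne C_sub dist]] by blast
    then have "ereal (real n * L) \<le> R_n P rho M n D" using n_pos by blast
    from order_trans[OF this R] have "ereal (real n) * ereal L \<le> ereal (ln (MnC M n C))" by simp
    with lim show ?thesis by blast
  qed
  ultimately show ?thesis by blast
qed

end
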